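(* Let $U=(u_{kj})$ be a complex $r\times m$ matrix and $V=(v_{ik})$ an integer $s\times r$ matrix, and let $f:\mathbb C^m\dashrightarrow\mathbb C^s$ be the rational map with coordinates $f_i(x)=\prod_{k=1}^r(u_{k1}x_1+\dots+u_{km}x_m)^{v_{ik}}$, $i=1,\dots,s$. Let $Y_{UV}\subseteq\mathbb C^s$ be the Zariski closure of the image of $f$, and let $\mathrm{im}(U)\subseteq\mathbb C^r$ be the image of $U$. Then $\tau(Y_{UV})=V\cdot\tau(\mathrm{im}(U))$, i.e. the tropicalization of $Y_{UV}$ is the image of $\tau(\mathrm{im}(U))\subseteq\mathbb R^r$ under the linear map $\mathbb R^r\to\mathbb R^s$ given by $V$.
   Context: Let $K=\mathbb C\{\!\{\epsilon^{\mathbb R}\}\!\}$ be the field of (transfinite) Puiseux series with complex coefficients, real exponents and well-ordered support; the order of $z\in K^*$ is the smallest exponent appearing in $z$, and for $z\in(K^* )^s$, $\mathrm{order}(z)\in\mathbb R^s$ is taken coordinatewise. For an algebraic variety $Y\subseteq\mathbb C^s$ (or $\mathbb C^r$) defined over $\mathbb C$, its tropicalization $\tau(Y)$ is the closure of the set $\{\mathrm{order}(z): z\in Y(K)\cap(K^* )^s\}$; equivalently $\tau(Y)=\{w:\mathrm{in}_w(I_Y)\text{ contains no monomial}\}$, where $\mathrm{in}_w$ takes lowest $w$-weight terms. $\tau(\mathrm{im}(U))$ is the Bergman fan of $U$: the set of $w\in\mathbb R^r$ such that every element of $[r]$ lies in some basis of the row matroid of $U$ of maximal $w$-weight. *)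

theory Defs
  imports "HOL-Analysis.Analysis" "HOL-Library.Poly_Mapping"
begin

type_synonym 'n cpoly = "('n \<Rightarrow>\<^sub>0 nat) \<Rightarrow>\<^sub>0 complex"

definition mono_eval :: "('n::finite \<Rightarrow>\<^sub>0 nat) \<Rightarrow> complex^'n \<Rightarrow> complex" where
  "mono_eval \<alpha> x = (\<Prod>i\<in>UNIV. (x $ i) ^ Poly_Mapping.lookup \<alpha> i)"

definition peval :: "'n::finite cpoly \<Rightarrow> complex^'n \<Rightarrow> complex" where
  "peval p x = (\<Sum>\<alpha>\<in>Poly_Mapping.keys p. Poly_Mapping.lookup p \<alpha> * mono_eval \<alpha> x)"

definition vanishing_ideal :: "(complex^'n::finite) set \<Rightarrow> 'n cpoly set" where
  "vanishing_ideal S = {p. \<forall>x\<in>S. peval p x = 0}"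

definition zariski_closure :: "(complex^'n::finite) set \<Rightarrow> (complex^'n) set" where
  "zariski_closure S = {x. \<forall>p\<in>vanishing_ideal S. peval p x = 0}"

definition mweight :: "real^'n::finite \<Rightarrow> ('n \<Rightarrow>\<^sub>0 nat) \<Rightarrow> real" where
  "mweight w \<alpha> = (\<Sum>i\<in>UNIV. w $ i * real (Poly_Mapping.lookup \<alpha> i))"

definition initial_form :: "real^'n::finite \<Rightarrow> 'n cpoly \<Rightarrow> 'n cpoly" where
  "initial_form w p =
     (\<Sum>\<alpha>\<in>{\<alpha>\<in>Poly_Mapping.keys p. mweight w \<alpha> = Min (mweight w ` Poly_Mapping.keys p)}.
        Poly_Mapping.single \<alpha> (Poly_Mapping.lookup p \<alpha>))"

definition ideal_gen :: "'n::finite cpoly set \<Rightarrow> 'n cpoly set" where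
  "ideal_gen G = {p. \<exists>F c. finite F \<and> F \<subseteq> G \<and> p = (\<Sum>g\<in>F. c g * g)}"

definition initial_ideal :: "real^'n::finite \<Rightarrow> 'n cpoly set \<Rightarrow> 'n cpoly set" where
  "initial_ideal w I = ideal_gen (initial_form w ` I)"

text \<open>Tropicalization of a variety Y (given by its set of C-points) via the initial-ideal
  characterization: w such that in_w(I_Y) contains no monomial.\<close>
definition tropicalization :: "(complex^'n::finite) set \<Rightarrow> (real^'n) set" where
  "tropicalization Y =
     {w. \<forall>\<alpha>. Poly_Mapping.single \<alpha> (1::complex) \<notin> initial_ideal w (vanishing_ideal Y)}"

definition monomial_map ::
  "complex^'m::finite^'r::finite \<Rightarrow> int^'r^'s::finite \<Rightarrow> complex^'m \<Rightarrow> complex^'s" where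
  "monomial_map U V x = (\<chi> i. \<Prod>k\<in>UNIV. ((U *v x) $ k) powi (V $ i $ k))"

definition map_domain :: "complex^'m::finite^'r::finite \<Rightarrow> (complex^'m) set" where
  "map_domain U = {x. \<forall>k. (U *v x) $ k \<noteq> 0}"

definition Y_UV :: "complex^'m::finite^'r::finite \<Rightarrow> int^'r^'s::finite \<Rightarrow> (complex^'s) set" where
  "Y_UV U V = zariski_closure (monomial_map U V ` map_domain U)"

end

theory Submission
  imports Defs "HOL-Library.Function_Algebras"
begin

text \<open>
  Call \<open>v\<close> balanced if no linear relation between the coordinates on \<open>im U\<close> has a strictly unique
  term of minimal \<open>v\<close>-weight. If \<open>v\<close> is balanced, a basis of the row matroid adapted to \<open>v\<close> gives a
  path \<open>x t\<close> whose image \<open>U *v x t\<close> is asymptotic to \<open>t powr v\<close>, coordinate by coordinate with non-zero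
  constants, as \<open>t\<close> tends to 0 from the right; its monomial image is asymptotic to \<open>t powr (V *v v)\<close>,
  and every initial form vanishes at the point formed by the leading constants. Hence \<open>v\<close> and \<open>V *v v\<close>
  are tropical.

  Conversely let \<open>w\<close> be tropical for \<open>Y_UV\<close>. Then 1 is not in the ring without unit \<open>P\<close> spanned by the
  monomials of positive \<open>w\<close>-weight in the coordinates of the monomial map. By Zorn, \<open>P\<close> lies in a
  maximal such ring \<open>M\<close>. As in Chevalley's extension theorem, the stabiliser of \<open>M\<close> behaves like a
  valuation ring with maximal ideal \<open>M\<close> as far as units are concerned, so it preorders the
  Laurent monomials in the linear forms. The value group need not embed into the reals, but
  Fourier--Motzkin elimination over the integers turns finitely many of its inequalities into a real
  vector \<open>v\<close> with \<open>w = V *v v\<close>, and comparing ratios of two linear forms suffices for \<open>v\<close> to be balanced.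
\<close>

section \<open>Maximal rings without unit\<close>

text \<open>The scalars \<open>K\<close> act on \<open>M\<close> and need not lie in it, so
  \<open>M\<close> can avoid 1. Negation comes from the scalar -1, which the locale below puts into
  \<open>K\<close>.\<close>

definition subrng :: "'a::comm_ring_1 set \<Rightarrow> 'a set \<Rightarrow> bool" where
  "subrng K M \<longleftrightarrow> 0 \<in> M \<and> (\<forall>a\<in>M. \<forall>b\<in>M. a + b \<in> M) \<and> (\<forall>a\<in>M. \<forall>b\<in>M. a * b \<in> M)
     \<and> (\<forall>a\<in>K. \<forall>b\<in>M. a * b \<in> M)"

lemma subrng_Union_chain:
  assumes "subset.chain {M. subrng K M} C" "C \<noteq> {}"
  shows "subrng K (\<Union>C)"
proof -
  have C: "\<And>M. M \<in> C \<Longrightarrow> subrng K M"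
    and lin: "\<And>M N. M \<in> C \<Longrightarrow> N \<in> C \<Longrightarrow> M \<subseteq> N \<or> N \<subseteq> M"
    using assms(1) by (auto simp: subset_chain_def)
  have two: "\<exists>M\<in>C. a \<in> M \<and> b \<in> M" if "a \<in> \<Union>C" "b \<in> \<Union>C" for a b
    proof -
    obtain A B where AB: "A \<in> C" "a \<in> A" "B \<in> C" "b \<in> B" using \<open>a \<in> \<Union>C\<close> \<open>b \<in> \<Union>C\<close> by blast
    then show ?thesis using lin[of A B] by blast
  qed
  have "a + b \<in> \<Union>C \<and> a * b \<in> \<Union>C" if ab: "a \<in> \<Union>C" "b \<in> \<Union>C" for a b
  proof -
    obtain M where "M \<in> C" "a \<in> M" "b \<in> M" using two[OF ab] by blast
    then have "a + b \<in> M" "a * b \<in> M" using C[of M] by (auto simp: subrng_def)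
    then show ?thesis using \<open>M \<in> C\<close> by blast
  qed
  moreover have "0 \<in> \<Union>C" using assms(2) C by (auto simp: subrng_def)
  moreover have "a * b \<in> \<Union>C" if "a \<in> K" "b \<in> \<Union>C" for a b
    using that C unfolding subrng_def by blast
  ultimately show ?thesis by (auto simp: subrng_def)
qed

text \<open>\<open>M\<close> plays the part of the maximal ideal of a valuation ring. Only this one
  set is maximised; the ring that belongs to it is recovered afterwards as
  \<open>stab\<close>.\<close>

locale maximal_subrng =
  fixes K M :: "'a::comm_ring_1 set"
  assumes subrng: "subrng K M" and minus_one: "-1 \<in> K" and one_notin: "1 \<notin> M"
    and maximal: "\<And>N. subrng K N \<Longrightarrow> 1 \<notin> N \<Longrightarrow> M \<subseteq> N \<Longrightarrow> N = M"

lemma ex_maximal_subrng: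
  assumes "subrng K M0" "1 \<notin> M0" "-1 \<in> K"
  shows "\<exists>M. maximal_subrng K M \<and> M0 \<subseteq> M"
proof -
  let ?A = "{M. subrng K M \<and> 1 \<notin> M \<and> M0 \<subseteq> M}"
  have "\<exists>M\<in>?A. \<forall>X\<in>?A. M \<subseteq> X \<longrightarrow> X = M"
  proof (rule subset_Zorn_nonempty)
    show "?A \<noteq> {}" using assms by auto
    fix C assume C: "C \<noteq> {}" "subset.chain ?A C"
    then have "subset.chain {M. subrng K M} C" by (auto simp: subset_chain_def)
    then have "subrng K (\<Union>C)" using C(1) subrng_Union_chain by blast
    then show "\<Union>C \<in> ?A" using C by (auto simp: subset_chain_def)
  qed
  then obtain M where M: "M \<in> ?A" "\<forall>X\<in>?A. M \<subseteq> X \<longrightarrow> X = M" by blast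
  then have "maximal_subrng K M" using assms(3) by unfold_locales blast+
  then show ?thesis using M(1) by blast
qed

section \<open>Units and the stabiliser of a maximal ring\<close>

context maximal_subrng
begin

lemma zero: "0 \<in> M" and add: "a \<in> M \<Longrightarrow> b \<in> M \<Longrightarrow> a + b \<in> M"
  and mult: "a \<in> M \<Longrightarrow> b \<in> M \<Longrightarrow> a * b \<in> M"
  and scale: "c \<in> K \<Longrightarrow> b \<in> M \<Longrightarrow> c * b \<in> M"
  using subrng by (auto simp: subrng_def)

lemma sum: "(\<And>i. i \<in> I \<Longrightarrow> f i \<in> M) \<Longrightarrow> (\<Sum>i\<in>I. f i) \<in> M"
  by (induction I rule: infinite_finite_induct) (auto simp: zero add)

text \<open>The idealiser of \<open>M\<close>: it contains \<open>M\<close> as an ideal and stands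
  in for the valuation ring.\<close>

definition stab :: "'a set" where "stab = {b. \<forall>m\<in>M. b * m \<in> M}"

lemma stabD: "b \<in> stab \<Longrightarrow> m \<in> M \<Longrightarrow> b * m \<in> M"
  by (auto simp: stab_def)

lemma stab_mult: "a \<in> stab \<Longrightarrow> b \<in> stab \<Longrightarrow> a * b \<in> stab"
  by (auto simp: stab_def mult.assoc)

lemma stab_one: "1 \<in> stab" by (simp add: stab_def)

lemma stab_add: "a \<in> stab \<Longrightarrow> b \<in> stab \<Longrightarrow> a + b \<in> stab"
  by (auto simp: stab_def algebra_simps add)

lemma subset_stab: "M \<subseteq> stab" by (auto simp: stab_def mult)

lemma scalars_subset_stab: "K \<subseteq> stab" by (auto simp: stab_def scale)

text \<open>Values in the ring, not formal polynomials. All coefficients, the constant one included,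
  lie in \<open>M\<close>, so \<open>1 \<in> pols u n\<close> is a genuine relation for
  \<open>u\<close>.\<close>

definition pols :: "'a \<Rightarrow> nat \<Rightarrow> 'a set" where
  "pols u n = {\<Sum>i\<le>n. a i * u ^ i | a. range a \<subseteq> M}"

lemma pols_add: "p \<in> pols u n \<Longrightarrow> q \<in> pols u n \<Longrightarrow> p + q \<in> pols u n"
proof -
  assume "p \<in> pols u n" "q \<in> pols u n"
  then obtain a b where "p = (\<Sum>i\<le>n. a i * u ^ i)" "q = (\<Sum>i\<le>n. b i * u ^ i)"
    "range a \<subseteq> M" "range b \<subseteq> M" by (auto simp: pols_def)
  then show ?thesis unfolding pols_def
    by (auto simp: sum.distrib[symmetric] distrib_right[symmetric] intro!: exI[of _ "\<lambda>i. a i + b i"] add)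
qed

lemma pols_stab: "c \<in> stab \<Longrightarrow> p \<in> pols u n \<Longrightarrow> c * p \<in> pols u n"
proof -
  assume c: "c \<in> stab" and "p \<in> pols u n"
  then obtain a where "p = (\<Sum>i\<le>n. a i * u ^ i)" "range a \<subseteq> M" by (auto simp: pols_def)
  then show ?thesis unfolding pols_def using c
    by (auto simp: sum_distrib_left mult.assoc intro!: exI[of _ "\<lambda>i. c * a i"] stabD)
qed

lemma pols_monom: "m \<in> M \<Longrightarrow> i \<le> n \<Longrightarrow> m * u ^ i \<in> pols u n"
  unfolding pols_def
  by (auto intro!: exI[of _ "\<lambda>j. if j = i then m else 0"] simp: zero if_distrib[of "\<lambda>x. x * _"] sum.delta cong: if_cong)

lemma pols_zero: "0 \<in> pols u n"
  using pols_monom[OF zero, of 0 n u] by simp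

lemma pols_const: "m \<in> M \<Longrightarrow> m \<in> pols u n"
  using pols_monom[of m 0 n u] by simp

lemma pols_sum: "(\<And>i. i \<in> I \<Longrightarrow> f i \<in> pols u n) \<Longrightarrow> (\<Sum>i\<in>I. f i) \<in> pols u n"
  by (induction I rule: infinite_finite_induct) (auto simp: pols_zero pols_add)

lemma pols_mult: "p \<in> pols u n \<Longrightarrow> q \<in> pols u k \<Longrightarrow> p * q \<in> pols u (n + k)"
proof -
  assume "p \<in> pols u n" "q \<in> pols u k"
  then obtain a b where ab: "p = (\<Sum>i\<le>n. a i * u ^ i)" "q = (\<Sum>i\<le>k. b i * u ^ i)"
    "range a \<subseteq> M" "range b \<subseteq> M" by (auto simp: pols_def)
  have "a i * u ^ i * (b j * u ^ j) \<in> pols u (n + k)" if "i \<le> n" "j \<le> k" for i j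
    using pols_monom[of "a i * b j" "i + j" "n + k" u] that ab(3,4)
    by (simp add: mult range_subsetD power_add algebra_simps)
  then show ?thesis unfolding ab sum_product by (intro pols_sum) auto
qed

lemma pols_mono: "n \<le> k \<Longrightarrow> pols u n \<subseteq> pols u k"
proof
  fix p assume "n \<le> k" "p \<in> pols u n"
  then show "p \<in> pols u k" unfolding pols_def[of u n]
    by (auto intro!: pols_sum pols_monom simp: range_subsetD)
qed

lemma pols_0: "pols u 0 = M"
  by (auto simp: pols_def intro!: exI[of _ "\<lambda>_. x" for x])

text \<open>The union of all \<open>pols u n\<close> is again closed and contains \<open>M\<close>.
  Without 1 it would equal \<open>M\<close> by maximality, and then \<open>u\<close> would map
  \<open>M\<close> into itself.\<close>

lemma one_in_pols:
  assumes "u \<notin> stab" shows "\<exists>n. 1 \<in> pols u n"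
proof (rule ccontr)
  assume n: "\<not> ?thesis"
  let ?N = "\<Union>n. pols u n"
  have lift: "\<exists>n. p \<in> pols u n \<and> q \<in> pols u n" if pq: "p \<in> ?N" "q \<in> ?N" for p q
  proof -
    obtain i j where "p \<in> pols u i" "q \<in> pols u j" using pq by blast
    then show ?thesis using pols_mono[of i "max i j" u] pols_mono[of j "max i j" u] by auto
  qed
  have "subrng K ?N"
    unfolding subrng_def
  proof (intro conjI ballI)
    show "0 \<in> ?N" using pols_zero by blast
    show "a + b \<in> ?N" if "a \<in> ?N" "b \<in> ?N" for a b using lift[OF that] pols_add by blast
    show "a * b \<in> ?N" if "a \<in> ?N" "b \<in> ?N" for a b using lift[OF that] pols_mult by blast
    show "a * b \<in> ?N" if "a \<in> K" "b \<in> ?N" for a b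
      using that pols_stab scalars_subset_stab by blast
  qed
  moreover have "M \<subseteq> ?N" using pols_const by blast
  ultimately have N: "?N = M" using n maximal by blast
  have "u * m \<in> M" if "m \<in> M" for m
  proof -
    have "m * u ^ 1 \<in> pols u 1" using that by (intro pols_monom) auto
    then show ?thesis using N by (auto simp: mult.commute)
  qed
  then show False using assms by (auto simp: stab_def)
qed

lemma pols_Suc: "p \<in> pols u (Suc n) \<Longrightarrow> \<exists>q\<in>pols u n. \<exists>m\<in>M. p = q + m * u ^ Suc n"
  unfolding pols_def by (auto simp: range_subsetD) blast

text \<open>Multiplication by \<open>u ^ Suc k\<close> turns \<open>v ^ i\<close> into
  \<open>u ^ (Suc k - i)\<close>. Only the constant coefficient would keep degree
  \<open>Suc k\<close>, so it is subtracted as \<open>m\<close>.\<close>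

lemma pols_split_const:
  assumes "u * v = 1" "p \<in> pols v n" "n \<le> Suc k"
  shows "\<exists>m\<in>M. u ^ Suc k * (p - m) \<in> pols u k"
proof -
  obtain a where a: "p = (\<Sum>i\<le>n. a i * v ^ i)" "range a \<subseteq> M" using assms(2) by (auto simp: pols_def)
  have p: "p - a 0 = (\<Sum>i\<in>{1..n}. a i * v ^ i)"
    unfolding a(1) by (simp add: atMost_atLeast0 sum.atLeast_Suc_atMost)
  have "u ^ Suc k * (a i * v ^ i) = a i * u ^ (Suc k - i)" if "i \<in> {1..n}" for i
  proof -
    have "u ^ Suc k = u ^ (Suc k - i) * u ^ i" using that assms(3) by (simp flip: power_add)
    then have "u ^ Suc k * (a i * v ^ i) = a i * u ^ (Suc k - i) * (u * v) ^ i"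
      by (simp only: power_mult_distrib mult_ac)
    then show ?thesis using assms(1) by simp
  qed
  then have "u ^ Suc k * (p - a 0) = (\<Sum>i\<in>{1..n}. a i * u ^ (Suc k - i))"
    unfolding p sum_distrib_left by (intro sum.cong) auto
  moreover have "\<dots> \<in> pols u k" using a(2) by (intro pols_sum pols_monom) auto
  ultimately have "u ^ Suc k * (p - a 0) \<in> pols u k" by simp
  moreover have "a 0 \<in> M" using a(2) by auto
  ultimately show ?thesis by blast
qed

text \<open>The degree reduction in Chevalley's theorem, with both sides multiplied by \<open>1 - m'\<close> instead of
  divided by it, so that nothing has to be localised at \<open>M\<close>.\<close>
lemma pols_reduce:
  assumes "u * v = 1" "1 \<in> pols u n" "1 \<in> pols v n'" "n' \<le> n"
  shows "\<exists>k<n. 1 \<in> pols u k"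
proof (cases n)
  case 0
  then show ?thesis using assms one_notin pols_0 by auto
next
  case (Suc k)
  obtain q m where q: "q \<in> pols u k" "m \<in> M" "1 = q + m * u ^ Suc k"
    using pols_Suc assms(2) Suc by blast
  obtain m' where m': "m' \<in> M" "u ^ Suc k * (1 - m') \<in> pols u k"
    using pols_split_const assms Suc by blast
  have "1 = m' + (1 - m') * (q + m * u ^ Suc k)" using q(3) by simp
  then have "1 = m' + (q + ((-1 * m') * q + m * (u ^ Suc k * (1 - m'))))"
    by (simp add: algebra_simps)
  moreover have "-1 * m' \<in> M" using scale minus_one m' by blast
  then have "-1 * m' \<in> stab" "m \<in> stab" using q subset_stab by auto
  then have "m' + (q + ((-1 * m') * q + m * (u ^ Suc k * (1 - m')))) \<in> pols u k"
    using q m' by (intro pols_add pols_const[of m'] pols_stab[of "-1 * m'"] pols_stab[of m])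
  ultimately have "1 \<in> pols u k" by simp
  then show ?thesis using Suc by blast
qed

text \<open>If both fail, 1 has representations of minimal degree in \<open>u\<close> and in
  \<open>v\<close>; \<open>pols_reduce\<close> lowers whichever degree is the larger.\<close>

lemma stab_total:
  assumes "u * v = 1" shows "u \<in> stab \<or> v \<in> stab"
proof (rule ccontr)
  assume "\<not> ?thesis"
  then have ex: "\<exists>n. 1 \<in> pols u n" "\<exists>n. 1 \<in> pols v n" using one_in_pols by auto
  define n where "n = (LEAST n. 1 \<in> pols u n)"
  define n' where "n' = (LEAST n. 1 \<in> pols v n)"
  have n: "1 \<in> pols u n" "1 \<in> pols v n'" using ex unfolding n_def n'_def by (auto intro: LeastI_ex)
  show False
  proof (cases "n' \<le> n")
    case True
    then obtain k where "k < n" "1 \<in> pols u k" using pols_reduce[OF assms] n by blast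
    then show False using not_less_Least[of k "\<lambda>n. 1 \<in> pols u n"] by (simp add: n_def)
  next
    case False
    moreover have "v * u = 1" using assms by (simp add: mult.commute)
    ultimately obtain k where "k < n'" "1 \<in> pols v k" using pols_reduce[of v u n' n] n by auto
    then show False using not_less_Least[of k "\<lambda>n. 1 \<in> pols v n"] by (simp add: n'_def)
  qed
qed

text \<open>Maximality makes \<open>u\<close> invertible modulo \<open>M\<close> inside
  \<open>stab\<close>. If \<open>v\<close> were outside \<open>stab\<close>, this would shorten the
  shortest representation of 1 as a polynomial in \<open>v\<close>.\<close>

lemma stab_inverse:
  assumes "u * v = 1" "u \<in> stab" "u \<notin> M" shows "v \<in> stab"
proof (rule ccontr)
  assume v: "v \<notin> stab"
  \<comment> \<open>This set is closed under products because \<open>u\<close> lies in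
    \<open>stab\<close>. It contains \<open>u\<close>, which is not in \<open>M\<close>, so
    maximality forces 1 into it.\<close>
  let ?N = "{m + u * b | m b. m \<in> M \<and> b \<in> stab}"
  have "subrng K ?N" unfolding subrng_def
  proof (intro conjI ballI)
    have z: "0 \<in> stab" using zero subset_stab by blast
    show "0 \<in> ?N" using zero z by force
    fix a b assume "b \<in> ?N"
    then obtain m c where m: "b = m + u * c" "m \<in> M" "c \<in> stab" by auto
    { assume "a \<in> ?N"
      then obtain m' c' where m': "a = m' + u * c'" "m' \<in> M" "c' \<in> stab" by auto
      have "a + b = (m + m') + u * (c + c')" using m m' by (simp add: algebra_simps)
      then show "a + b \<in> ?N" using m m' add stab_add by blast
      have "a * b = m' * m + u * (c' * m + (m' * c + c' * (u * c)))"
        using m m' by (simp add: algebra_simps)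
      moreover have "c' * m + (m' * c + c' * (u * c)) \<in> stab"
        using m m' assms(2) subset_stab by (intro stab_add stab_mult) auto
      ultimately show "a * b \<in> ?N" using m m' mult by blast }
    { assume "a \<in> K"
      then have "a * b = a * m + u * (a * c)" "a * m \<in> M" "a * c \<in> stab"
        using m scale stab_mult scalars_subset_stab by (auto simp: algebra_simps)
      then show "a * b \<in> ?N" by blast }
  qed
  moreover have "M \<subseteq> ?N"
  proof
    fix m assume "m \<in> M"
    moreover have "0 \<in> stab" using zero subset_stab by blast
    ultimately show "m \<in> ?N" by force
  qed
  moreover have "u \<in> ?N" using zero stab_one by force
  ultimately have "1 \<in> ?N" using maximal assms(3) by blast
  then obtain m b where mb: "1 = m + u * b" "m \<in> M" "b \<in> stab" by auto
  define n where "n = (LEAST n. 1 \<in> pols v n)"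
  have n: "1 \<in> pols v n" unfolding n_def using one_in_pols[OF v] by (rule LeastI_ex)
  then obtain k where k: "n = Suc k" using one_notin pols_0 by (cases n) auto
  obtain q m' where q: "q \<in> pols v k" "m' \<in> M" "1 = q + m' * v ^ Suc k"
    using n k pols_Suc by blast
  \<comment> \<open>The factor \<open>u\<close> of \<open>1 - m\<close> cancels one
    \<open>v\<close>, so multiplying the top term by \<open>1 - m\<close> lowers its degree from
    \<open>Suc k\<close> to \<open>k\<close>.\<close>
  have "1 - m = u * b" using mb(1) by (simp add: algebra_simps)
  then have "(1 - m) * v ^ Suc k = b * ((u * v) * v ^ k)" by (simp only: power_Suc mult_ac)
  then have e: "(1 - m) * v ^ Suc k = b * v ^ k" using assms(1) by simp
  have "1 = m + (1 - m) * (q + m' * v ^ Suc k)" using q(3) by simp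
  also have "\<dots> = m + (q + ((-1 * m) * q + m' * ((1 - m) * v ^ Suc k)))"
    by (simp add: algebra_simps)
  also have "\<dots> = m + (q + ((-1 * m) * q + (b * m') * v ^ k))"
    unfolding e by (simp add: algebra_simps)
  finally have "1 = m + (q + ((-1 * m) * q + (b * m') * v ^ k))" .
  moreover have "-1 * m \<in> stab" using scale minus_one mb subset_stab by blast
  moreover have "(b * m') * v ^ k \<in> pols v k" using mb q by (intro pols_monom stabD) auto
  then have "m + (q + ((-1 * m) * q + (b * m') * v ^ k)) \<in> pols v k"
    using q mb \<open>-1 * m \<in> stab\<close> by (intro pols_add pols_const[of m] pols_stab[of "-1 * m"])
  ultimately have "1 \<in> pols v k" by simp
  then show False using not_less_Least[of k "\<lambda>n. 1 \<in> pols v n"] k n_def by simp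
qed

end

section \<open>Fourier--Motzkin elimination over the integers\<close>

lemma finite_sandwich:
  fixes L R :: "real set"
  assumes "finite L" "finite R" "\<And>l r. l \<in> L \<Longrightarrow> r \<in> R \<Longrightarrow> l \<le> r"
  shows "\<exists>x. (\<forall>l\<in>L. l \<le> x) \<and> (\<forall>r\<in>R. x \<le> r)"
proof (cases "L = {}")
  case True
  then show ?thesis using assms(2) by (cases "R = {}") (auto intro!: exI[of _ "Min R"])
next
  case False
  then have "Max L \<in> L" using assms(1) by simp
  then show ?thesis using assms by (intro exI[of _ "Max L"]) auto
qed

text \<open>A pair \<open>(e, \<beta>)\<close> encodes the inequality
  \<open>\<beta> \<le> (\<Sum>k. e k * v k)\<close>, and \<open>le0\<close> forbids contradictory
  constants. Variables are eliminated one by one; additive closure yields only positive integer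
  multiples, which suffice because the coefficients are integers.\<close>

lemma integral_fourier_motzkin:
  fixes G :: "(('k \<Rightarrow> int) \<times> real) set"
  assumes add: "\<And>e f \<beta> \<gamma>. (e, \<beta>) \<in> G \<Longrightarrow> (f, \<gamma>) \<in> G \<Longrightarrow> (\<lambda>k. e k + f k, \<beta> + \<gamma>) \<in> G"
    and le0: "\<And>\<beta>. (\<lambda>_. 0, \<beta>) \<in> G \<Longrightarrow> \<beta> \<le> 0"
    and "finite T" "finite S" "S \<subseteq> G" "\<And>e \<beta> k. (e, \<beta>) \<in> S \<Longrightarrow> k \<notin> T \<Longrightarrow> e k = 0"
  shows "\<exists>v. \<forall>(e, \<beta>)\<in>S. \<beta> \<le> (\<Sum>k\<in>T. of_int (e k) * v k)"
  using assms(3-)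
proof (induction T arbitrary: S rule: finite_induct)
  case empty
  have "\<beta> \<le> 0" if "(e, \<beta>) \<in> S" for e \<beta>
  proof -
    have "e = (\<lambda>_. 0)" using empty.prems(3) that by auto
    then show ?thesis using le0 that empty.prems(2) by auto
  qed
  then show ?case by auto
next
  case (insert t T)
  \<comment> \<open>Multiples start at \<open>Suc n\<close> because the zero multiple need not lie
    in \<open>G\<close>.\<close>
  have mult: "(\<lambda>k. int (Suc n) * e k, real (Suc n) * \<beta>) \<in> G" if "(e, \<beta>) \<in> G" for n e \<beta>
  proof (induction n)
    case 0
    then show ?case using that by simp
  next
    case (Suc n)
    then show ?case using add[OF that Suc] by (simp add: algebra_simps)
  qed
  have mult: "(\<lambda>k. a * e k, of_int a * \<beta>) \<in> G" if "(e, \<beta>) \<in> G" "a > 0" for a e \<beta>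
  proof -
    obtain n where "a = int (Suc n)" using \<open>a > 0\<close> by (metis zero_less_imp_eq_int gr0_implies_Suc)
    then show ?thesis using mult[OF \<open>(e, \<beta>) \<in> G\<close>, of n] by simp
  qed
  \<comment> \<open>Cross-multiplication cancels the coefficient at \<open>t\<close>. Both
    multipliers are positive when the first pair is in \<open>Sp\<close> and the second in
    \<open>Sn\<close>.\<close>
  define comb where "comb = (\<lambda>((e :: 'k \<Rightarrow> int, \<beta> :: real), (f, \<gamma>)).
     (\<lambda>k. (- f t) * e k + e t * f k, of_int (- f t) * \<beta> + of_int (e t) * \<gamma>))"
  define Sp where "Sp = {p \<in> S. fst p t > 0}"
  define Sn where "Sn = {p \<in> S. fst p t < 0}"
  define S' where "S' = {p \<in> S. fst p t = 0} \<union> comb ` (Sp \<times> Sn)"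
  have "finite Sp" "finite Sn" using insert.prems(1) by (auto simp: Sp_def Sn_def)
  have "\<exists>v. \<forall>(e, \<beta>)\<in>S'. \<beta> \<le> (\<Sum>k\<in>T. of_int (e k) * v k)"
  proof (rule insert.IH)
    show "finite S'" using insert.prems(1) by (auto simp: S'_def Sp_def Sn_def)
    show "S' \<subseteq> G"
      using insert.prems(2)
      by (auto simp: S'_def Sp_def Sn_def comb_def simp del: of_int_minus mult_minus_left intro!: add mult)
    show "e k = 0" if "(e, \<beta>) \<in> S'" "k \<notin> T" for e \<beta> k
    proof (cases "k = t")
      case True
      then show ?thesis using that by (auto simp: S'_def comb_def)
    next
      case False
      then have z: "fst p k = 0" if "p \<in> S" for p
        using that \<open>k \<notin> T\<close> insert.prems(3)[of "fst p" "snd p" k] by simp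
      show ?thesis using that
        by (auto simp: S'_def Sp_def Sn_def comb_def dest!: z)
    qed
  qed
  then obtain v where v: "\<And>e \<beta>. (e, \<beta>) \<in> S' \<Longrightarrow> \<beta> \<le> (\<Sum>k\<in>T. of_int (e k) * v k)" by blast
  \<comment> \<open>The inequality solved for the value at \<open>t\<close>: a lower bound for pairs
    in \<open>Sp\<close>, an upper bound for pairs in \<open>Sn\<close>. The inequalities from
    \<open>comb\<close> say that these bounds are compatible.\<close>
  define bnd where "bnd = (\<lambda>(e, \<beta>). (\<beta> - (\<Sum>k\<in>T. of_int (e k) * v k)) / of_int (e t))"
  have "\<exists>x. (\<forall>l\<in>bnd ` Sp. l \<le> x) \<and> (\<forall>r\<in>bnd ` Sn. x \<le> r)"
  proof (rule finite_sandwich)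
    show "finite (bnd ` Sp)" "finite (bnd ` Sn)" using \<open>finite Sp\<close> \<open>finite Sn\<close> by auto
    fix l r assume "l \<in> bnd ` Sp" "r \<in> bnd ` Sn"
    then obtain e \<beta> f \<gamma> where p: "(e, \<beta>) \<in> Sp" "(f, \<gamma>) \<in> Sn" "l = bnd (e, \<beta>)" "r = bnd (f, \<gamma>)" by auto
    have s: "e t > 0" "f t < 0" using p by (auto simp: Sp_def Sn_def)
    have "comb ((e, \<beta>), (f, \<gamma>)) \<in> S'" using p by (auto simp: S'_def)
    then have "of_int (- f t) * \<beta> + of_int (e t) * \<gamma>
        \<le> (\<Sum>k\<in>T. of_int ((- f t) * e k + e t * f k) * v k)"
      unfolding comb_def by (auto dest!: v simp del: of_int_minus of_int_add of_int_mult)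
    also have "\<dots> = of_int (- f t) * (\<Sum>k\<in>T. of_int (e k) * v k) + of_int (e t) * (\<Sum>k\<in>T. of_int (f k) * v k)"
      by (simp add: sum_distrib_left sum.distrib[symmetric] algebra_simps)
    finally show "l \<le> r" using s unfolding p bnd_def
      by (simp add: divide_simps) (simp add: algebra_simps)
  qed
  then obtain x where x: "\<And>p. p \<in> Sp \<Longrightarrow> bnd p \<le> x" "\<And>p. p \<in> Sn \<Longrightarrow> x \<le> bnd p" by blast
  let ?v = "v(t := x)"
  have T: "(\<Sum>k\<in>insert t T. of_int (e k) * ?v k) = of_int (e t) * x + (\<Sum>k\<in>T. of_int (e k) * v k)" for e
    using insert.hyps by (auto intro!: sum.cong)
  have "\<beta> \<le> (\<Sum>k\<in>insert t T. of_int (e k) * ?v k)" if S: "(e, \<beta>) \<in> S" for e \<beta>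
  proof -
    consider "e t = 0" | "e t > 0" | "e t < 0" by linarith
    then show ?thesis
    proof cases
      case 1
      then show ?thesis unfolding T using v[of e \<beta>] S by (auto simp: S'_def)
    next
      case 2
      then have "bnd (e, \<beta>) \<le> x" using x S by (auto simp: Sp_def)
      then show ?thesis unfolding T using 2 by (simp add: bnd_def divide_simps) (simp add: algebra_simps)
    next
      case 3
      then have "x \<le> bnd (e, \<beta>)" using x S by (auto simp: Sn_def)
      then show ?thesis unfolding T using 3 by (simp add: bnd_def divide_simps) (simp add: algebra_simps)
    qed
  qed
  then show ?case by blast
qed

section \<open>Initial forms and limits\<close>

lemma peval_superset:
  assumes "finite A" "Poly_Mapping.keys p \<subseteq> A"
  shows "peval p x = (\<Sum>\<alpha>\<in>A. Poly_Mapping.lookup p \<alpha> * mono_eval \<alpha> x)"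
  unfolding peval_def using assms by (intro sum.mono_neutral_left) (auto simp: in_keys_iff)

lemma peval_zero: "peval 0 x = 0"
  by (simp add: peval_def)

lemma peval_single: "peval (Poly_Mapping.single \<alpha> c) x = c * mono_eval \<alpha> x"
  by (subst peval_superset[of "{\<alpha>}"]) auto

lemma peval_add: "peval (p + q) x = peval p x + peval q x"
proof -
  let ?A = "Poly_Mapping.keys p \<union> Poly_Mapping.keys q"
  have "Poly_Mapping.keys (p + q) \<subseteq> ?A" by (rule keys_add)
  then show ?thesis
    by (simp add: peval_superset[of ?A] lookup_add distrib_right sum.distrib)
qed

lemma peval_sum: "peval (\<Sum>i\<in>I. f i) x = (\<Sum>i\<in>I. peval (f i) x)"
  by (induction I rule: infinite_finite_induct) (auto simp: peval_zero peval_add)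

lemma mono_eval_add: "mono_eval (\<alpha> + \<beta>) x = mono_eval \<alpha> x * mono_eval \<beta> x"
  by (simp add: mono_eval_def lookup_add power_add prod.distrib)

lemma mono_eval_nonzero: "(\<And>i. x $ i \<noteq> 0) \<Longrightarrow> mono_eval \<alpha> x \<noteq> 0"
  by (simp add: mono_eval_def)

lemma poly_mapping_sum_single:
  "(\<Sum>\<alpha>\<in>Poly_Mapping.keys p. Poly_Mapping.single \<alpha> (Poly_Mapping.lookup p \<alpha>)) = p"
proof (rule poly_mapping_eqI)
  fix \<beta>
  show "Poly_Mapping.lookup (\<Sum>\<alpha>\<in>Poly_Mapping.keys p. Poly_Mapping.single \<alpha> (Poly_Mapping.lookup p \<alpha>)) \<beta>
      = Poly_Mapping.lookup p \<beta>"
    by (auto simp: lookup_sum lookup_single when_def in_keys_iff)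
qed

lemma peval_mult: "peval (p * q) x = peval p x * peval q x"
proof -
  have "p * q = (\<Sum>\<alpha>\<in>Poly_Mapping.keys p. \<Sum>\<beta>\<in>Poly_Mapping.keys q.
      Poly_Mapping.single (\<alpha> + \<beta>) (Poly_Mapping.lookup p \<alpha> * Poly_Mapping.lookup q \<beta>))"
    by (subst (1) poly_mapping_sum_single[symmetric, of p], subst (1) poly_mapping_sum_single[symmetric, of q])
       (simp add: sum_product mult_single)
  then show ?thesis
    by (simp only: peval_sum peval_single mono_eval_add) (simp add: peval_def sum_product mult_ac)
qed

text \<open>Used with a point \<open>e\<close> without zero coordinates: no monomial vanishes there,
  so none can lie in the initial ideal.\<close>

lemma initial_ideal_vanishes:
  assumes "\<And>p. p \<in> I \<Longrightarrow> peval (initial_form w p) e = 0" "q \<in> initial_ideal w I"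
  shows "peval q e = 0"
proof -
  obtain F c where F: "F \<subseteq> initial_form w ` I" "q = (\<Sum>g\<in>F. c g * g)"
    using assms(2) by (auto simp: initial_ideal_def ideal_gen_def)
  then have "peval g e = 0" if "g \<in> F" for g using that assms(1) by auto
  then show ?thesis by (simp add: F(2) peval_sum peval_mult)
qed

lemma initial_form_in_initial_ideal:
  assumes "p \<in> I" shows "initial_form w p \<in> initial_ideal w I"
  unfolding initial_ideal_def ideal_gen_def using assms
  by (auto intro!: exI[of _ "{initial_form w p}"] exI[of _ "\<lambda>_. 1"])

lemma initial_form_eq_single:
  assumes \<alpha>: "\<alpha> \<in> Poly_Mapping.keys p"
    and lt: "\<And>\<beta>. \<beta> \<in> Poly_Mapping.keys p \<Longrightarrow> \<beta> \<noteq> \<alpha> \<Longrightarrow> mweight w \<alpha> < mweight w \<beta>"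
  shows "initial_form w p = Poly_Mapping.single \<alpha> (Poly_Mapping.lookup p \<alpha>)"
proof -
  have "Min (mweight w ` Poly_Mapping.keys p) = mweight w \<alpha>"
  proof (rule Min_eqI)
    show "mweight w \<alpha> \<le> y" if "y \<in> mweight w ` Poly_Mapping.keys p" for y
      using that lt by (force simp: less_imp_le)
  qed (use \<alpha> in auto)
  then have "{\<beta> \<in> Poly_Mapping.keys p. mweight w \<beta> = Min (mweight w ` Poly_Mapping.keys p)} = {\<alpha>}"
    using \<alpha> lt by force
  then show ?thesis by (simp add: initial_form_def)
qed

text \<open>The unique lowest term is the whole initial form. Multiplying by the constant polynomial
  \<open>1 / ?c\<close> makes its coefficient 1, as the definition of \<open>tropicalization\<close>
  demands.\<close>

lemma not_in_tropicalization:
  assumes "p \<in> vanishing_ideal Y" "\<alpha> \<in> Poly_Mapping.keys p"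
    "\<And>\<beta>. \<beta> \<in> Poly_Mapping.keys p \<Longrightarrow> \<beta> \<noteq> \<alpha> \<Longrightarrow> mweight w \<alpha> < mweight w \<beta>"
  shows "w \<notin> tropicalization Y"
proof -
  let ?c = "Poly_Mapping.lookup p \<alpha>"
  let ?q = "Poly_Mapping.single 0 (1 / ?c) * p"
  have "?c \<noteq> 0" using assms(2) by (simp add: in_keys_iff)
  have lookup: "Poly_Mapping.lookup ?q \<beta> = Poly_Mapping.lookup p \<beta> / ?c" for \<beta>
  proof -
    have "?q = (\<Sum>\<alpha>'\<in>Poly_Mapping.keys p. Poly_Mapping.single \<alpha>' (Poly_Mapping.lookup p \<alpha>' / ?c))"
      by (subst (2) poly_mapping_sum_single[symmetric]) (simp add: sum_distrib_left mult_single)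
    then show ?thesis by (auto simp: lookup_sum lookup_single when_def in_keys_iff)
  qed
  then have "Poly_Mapping.keys ?q = Poly_Mapping.keys p" using \<open>?c \<noteq> 0\<close> by (auto simp: in_keys_iff)
  then have "initial_form w ?q = Poly_Mapping.single \<alpha> 1"
    using initial_form_eq_single[of \<alpha> ?q w] assms(2,3) lookup \<open>?c \<noteq> 0\<close> by simp
  moreover have "?q \<in> vanishing_ideal Y" using assms(1) by (simp add: vanishing_ideal_def peval_mult)
  ultimately show ?thesis
    using initial_form_in_initial_ideal[of ?q "vanishing_ideal Y" w] by (auto simp: tropicalization_def)
qed

lemma peval_initial_form:
  "peval (initial_form w p) e =
     (\<Sum>\<alpha>\<in>{\<alpha>\<in>Poly_Mapping.keys p. mweight w \<alpha> = Min (mweight w ` Poly_Mapping.keys p)}.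
        Poly_Mapping.lookup p \<alpha> * mono_eval \<alpha> e)"
  by (simp add: initial_form_def peval_sum peval_single)

section \<open>Limits along one-parameter paths\<close>

lemma eventually_pos_at_right: "eventually (\<lambda>t::real. t > 0) (at_right 0)"
  by (rule eventually_at_right_less)

text \<open>Here \<open>c\<close> will be the excess of a term over the minimal weight: terms
  without excess survive in the limit, all others die.\<close>

lemma tendsto_powr_at_right_0:
  fixes c :: real assumes "c \<ge> 0"
  shows "((\<lambda>t. of_real (t powr c) :: complex) \<longlongrightarrow> (if c = 0 then 1 else 0)) (at_right 0)"
proof (cases "c = 0")
  case True
  have "eventually (\<lambda>t. 1 = (of_real (t powr c) :: complex)) (at_right 0)"
    using eventually_pos_at_right by (rule eventually_mono) (simp add: True)
  then show ?thesis using True by (auto intro: Lim_transform_eventually[OF tendsto_const])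
next
  case False
  then have "((\<lambda>t. t powr c) \<longlongrightarrow> 0) (at_right 0)"
    by (intro tendsto_eq_rhs[OF tendsto_powr'[where f = "\<lambda>t. t" and a = 0]])
       (use assms in \<open>auto intro!: tendsto_intros eventually_at_right_less[THEN eventually_mono]\<close>)
  then show ?thesis using False tendsto_of_real[where 'a = complex] by fastforce
qed

text \<open>A real-parameter substitute for a Puiseux point: \<open>z t $ i\<close> behaves like
  \<open>e $ i\<close> times \<open>t powr (w $ i)\<close>, so \<open>w\<close> is the order and
  \<open>e\<close> the vector of leading coefficients.\<close>

definition tropical_limit :: "(real \<Rightarrow> complex^'n) \<Rightarrow> real^'n \<Rightarrow> complex^'n \<Rightarrow> bool" where
  "tropical_limit z w e \<longleftrightarrow> (\<forall>i. e $ i \<noteq> 0 \<and>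
     ((\<lambda>t. z t $ i * of_real (t powr (- (w $ i)))) \<longlongrightarrow> e $ i) (at_right 0))"

text \<open>Dividing \<open>peval p (z t) = 0\<close> by the lowest power of \<open>t\<close> and
  letting \<open>t\<close> tend to 0 leaves the initial form at \<open>e\<close>. Hence the whole
  initial ideal vanishes at \<open>e\<close>, where no monomial does.\<close>

lemma in_tropicalizationI:
  fixes Y :: "(complex^'n::finite) set"
  assumes "eventually (\<lambda>t. z t \<in> Y) (at_right 0)" and lim: "tropical_limit z w e"
  shows "w \<in> tropicalization Y"
proof -
  have "peval (initial_form w p) e = 0" if p: "p \<in> vanishing_ideal Y" for p
  proof -
    define \<mu> where "\<mu> = Min (mweight w ` Poly_Mapping.keys p)"
    let ?f = "\<lambda>t. peval p (z t) * of_real (t powr (- \<mu>))"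
    have mono: "((\<lambda>t. mono_eval \<alpha> (z t) * of_real (t powr (- mweight w \<alpha>))) \<longlongrightarrow> mono_eval \<alpha> e) (at_right 0)"
      (is "(?g \<longlongrightarrow> _) _") for \<alpha>
    proof -
      have "((\<lambda>t. \<Prod>i\<in>UNIV. (z t $ i * of_real (t powr (- (w $ i)))) ^ Poly_Mapping.lookup \<alpha> i)
          \<longlongrightarrow> mono_eval \<alpha> e) (at_right 0)"
        unfolding mono_eval_def using lim by (intro tendsto_intros) (auto simp: tropical_limit_def)
      moreover have "eventually (\<lambda>t. (\<Prod>i\<in>UNIV. (z t $ i * of_real (t powr (- (w $ i)))) ^ Poly_Mapping.lookup \<alpha> i)
          = ?g t) (at_right 0)"
        using eventually_pos_at_right
      proof (rule eventually_mono)
        fix t :: real assume "t > 0"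
        then have "(\<Prod>i\<in>UNIV. (t powr (- (w $ i))) ^ Poly_Mapping.lookup \<alpha> i) = t powr (- mweight w \<alpha>)"
          by (simp add: powr_power mweight_def powr_sum sum_negf[symmetric] mult_ac)
        then show "(\<Prod>i\<in>UNIV. (z t $ i * of_real (t powr (- (w $ i)))) ^ Poly_Mapping.lookup \<alpha> i) = ?g t"
          by (simp add: power_mult_distrib prod.distrib mono_eval_def flip: of_real_power of_real_prod)
      qed
      ultimately show ?thesis by (rule Lim_transform_eventually)
    qed
    have "((\<lambda>t. Poly_Mapping.lookup p \<alpha> * mono_eval \<alpha> (z t) * of_real (t powr (- \<mu>)))
       \<longlongrightarrow> (if mweight w \<alpha> = \<mu> then Poly_Mapping.lookup p \<alpha> * mono_eval \<alpha> e else 0)) (at_right 0)"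
      if "\<alpha> \<in> Poly_Mapping.keys p" for \<alpha>
    proof -
      have le: "\<mu> \<le> mweight w \<alpha>" using that by (simp add: \<mu>_def)
      \<comment> \<open>The factor \<open>t powr (- \<mu>)\<close> is split into the one that
        normalises the monomial \<alpha> and a power with the excess weight as exponent.\<close>
      have "((\<lambda>t. of_real (t powr (mweight w \<alpha> - \<mu>)) :: complex) \<longlongrightarrow>
          (if mweight w \<alpha> - \<mu> = 0 then 1 else 0)) (at_right 0)"
        using le by (intro tendsto_powr_at_right_0) auto
      note lim' = tendsto_mult[OF tendsto_const[of "Poly_Mapping.lookup p \<alpha>"] tendsto_mult[OF mono[of \<alpha>] this]]
      have "eventually (\<lambda>t. Poly_Mapping.lookup p \<alpha> * (mono_eval \<alpha> (z t) * of_real (t powr (- mweight w \<alpha>)) *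
          of_real (t powr (mweight w \<alpha> - \<mu>)))
          = Poly_Mapping.lookup p \<alpha> * mono_eval \<alpha> (z t) * of_real (t powr (- \<mu>))) (at_right 0)"
        using eventually_pos_at_right
        by (rule eventually_mono) (simp add: mult.assoc flip: of_real_mult powr_add)
      from Lim_transform_eventually[OF lim' this] show ?thesis by (auto split: if_splits)
    qed
    then have "(?f \<longlongrightarrow> (\<Sum>\<alpha>\<in>Poly_Mapping.keys p.
        if mweight w \<alpha> = \<mu> then Poly_Mapping.lookup p \<alpha> * mono_eval \<alpha> e else 0)) (at_right 0)"
      unfolding peval_def sum_distrib_right by (intro tendsto_sum)
    then have "(?f \<longlongrightarrow> peval (initial_form w p) e) (at_right 0)"
      unfolding peval_initial_form \<mu>_def by (simp add: sum.If_cases Int_def)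
    moreover have "eventually (\<lambda>t. 0 = ?f t) (at_right 0)"
      using assms(1) by (rule eventually_mono) (use p in \<open>simp add: vanishing_ideal_def\<close>)
    then have "(?f \<longlongrightarrow> 0) (at_right 0)" by (rule Lim_transform_eventually[OF tendsto_const])
    ultimately show ?thesis by (intro tendsto_unique) auto
  qed
  then have "peval q e = 0" if "q \<in> initial_ideal w (vanishing_ideal Y)" for q
    using initial_ideal_vanishes that by blast
  moreover have "peval (Poly_Mapping.single \<alpha> 1) e \<noteq> 0" for \<alpha>
    using lim by (simp add: peval_single mono_eval_nonzero tropical_limit_def)
  ultimately show ?thesis by (auto simp: tropicalization_def)
qed

lemma subset_zariski_closure: "S \<subseteq> zariski_closure S"
  by (auto simp: zariski_closure_def vanishing_ideal_def)

lemma vanishing_ideal_zariski_closure: "vanishing_ideal (zariski_closure S) = vanishing_ideal S"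
  by (auto simp: zariski_closure_def vanishing_ideal_def)

text \<open>Leading constants are non-zero, so integer powers, negative ones included, are
  continuous there; the orders combine linearly through \<open>V\<close>.\<close>

lemma tropical_limit_monomial_map:
  fixes U :: "complex^'m::finite^'r::finite" and V :: "int^'r^'s::finite"
  assumes "tropical_limit (\<lambda>t. U *v x t) v d"
  shows "tropical_limit (\<lambda>t. monomial_map U V (x t)) ((\<chi> i k. real_of_int (V $ i $ k)) *v v)
     (\<chi> i. \<Prod>k\<in>UNIV. d $ k powi (V $ i $ k))"
  unfolding tropical_limit_def
proof (intro allI conjI)
  fix i
  have d: "d $ k \<noteq> 0" and lim: "((\<lambda>t. (U *v x t) $ k * of_real (t powr (- (v $ k)))) \<longlongrightarrow> d $ k) (at_right 0)" for k
    using assms by (auto simp: tropical_limit_def)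
  show "(\<chi> i. \<Prod>k\<in>UNIV. d $ k powi (V $ i $ k)) $ i \<noteq> 0" using d by simp
  have "((\<lambda>t. \<Prod>k\<in>UNIV. ((U *v x t) $ k * of_real (t powr (- (v $ k)))) powi (V $ i $ k))
     \<longlongrightarrow> (\<Prod>k\<in>UNIV. d $ k powi (V $ i $ k))) (at_right 0)"
    using d lim by (intro tendsto_prod tendsto_power_int)
  moreover have "eventually (\<lambda>t. (\<Prod>k\<in>UNIV. ((U *v x t) $ k * of_real (t powr (- (v $ k)))) powi (V $ i $ k))
     = monomial_map U V (x t) $ i *
       of_real (t powr (- (((\<chi> i k. real_of_int (V $ i $ k)) *v v) $ i)))) (at_right 0)"
    using eventually_pos_at_right
  proof (rule eventually_mono)
    fix t :: real assume t: "t > 0"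
    then have "(\<Prod>k\<in>UNIV. (t powr (- (v $ k))) powi (V $ i $ k))
        = t powr (- (((\<chi> i k. real_of_int (V $ i $ k)) *v v) $ i))"
      by (simp add: powr_real_of_int' [symmetric] powr_powr matrix_vector_mult_def powr_sum sum_negf[symmetric] mult_ac)
    then show "(\<Prod>k\<in>UNIV. ((U *v x t) $ k * of_real (t powr (- (v $ k)))) powi (V $ i $ k))
      = monomial_map U V (x t) $ i * of_real (t powr (- (((\<chi> i k. real_of_int (V $ i $ k)) *v v) $ i)))"
      by (simp add: power_int_mult_distrib prod.distrib monomial_map_def flip: of_real_power_int of_real_prod)
  qed
  ultimately show "((\<lambda>t. monomial_map U V (x t) $ i *
       of_real (t powr (- (((\<chi> i k. real_of_int (V $ i $ k)) *v v) $ i)))) \<longlongrightarrow>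
       (\<chi> i. \<Prod>k\<in>UNIV. d $ k powi (V $ i $ k)) $ i) (at_right 0)"
    by (simp add: Lim_transform_eventually)
qed

text \<open>Used to place the path in \<open>map_domain\<close> for small \<open>t\<close>.\<close>

lemma tropical_limit_eventually_nonzero:
  assumes "tropical_limit z v (d :: complex^'n::finite)"
  shows "eventually (\<lambda>t. \<forall>k. z t $ k \<noteq> 0) (at_right 0)"
proof -
  have "eventually (\<lambda>t. z t $ k \<noteq> 0) (at_right 0)" for k
  proof -
    have "eventually (\<lambda>t. z t $ k * of_real (t powr (- (v $ k))) \<noteq> 0) (at_right 0)"
      using assms by (intro tendsto_imp_eventually_ne[of _ "d $ k"]) (auto simp: tropical_limit_def)
    then show ?thesis by (rule eventually_mono) auto
  qed
  then show ?thesis by (simp add: eventually_all_finite)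
qed

section \<open>Balanced vectors\<close>

definition balanced :: "complex^'m::finite^'r::finite \<Rightarrow> real^'r \<Rightarrow> bool" where
  "balanced U v \<longleftrightarrow> (\<forall>c j. (\<Sum>k\<in>UNIV. c k *s U $ k) = 0 \<longrightarrow> c j \<noteq> 0 \<longrightarrow>
     (\<exists>k. k \<noteq> j \<and> c k \<noteq> 0 \<and> v $ k \<le> v $ j))"

lemma relation_apply:
  fixes U :: "complex^'m::finite^'r::finite"
  shows "(\<Sum>k\<in>UNIV. c k * (U *v x) $ k) = (\<Sum>i\<in>UNIV. (\<Sum>k\<in>UNIV. c k *s U $ k) $ i * x $ i)"
  unfolding matrix_vector_mult_def
  by (simp add: sum_distrib_left sum_distrib_right mult.assoc) (rule sum.swap)

text \<open>A relation between rows is a linear form vanishing on the image; a strictly unique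
  lowest term would be its initial form.\<close>

lemma tropicalization_imp_balanced:
  fixes U :: "complex^'m::finite^'r::finite"
  assumes "v \<in> tropicalization (range (\<lambda>x. U *v x))"
  shows "balanced U v"
  unfolding balanced_def
proof (intro allI impI, rule ccontr)
  fix c j
  assume rel: "(\<Sum>k\<in>UNIV. c k *s U $ k) = 0" and "c j \<noteq> 0"
    and no: "\<not> (\<exists>k. k \<noteq> j \<and> c k \<noteq> 0 \<and> v $ k \<le> v $ j)"
  \<comment> \<open>The exponent vector of the variable with index \<open>k\<close>.\<close>
  define \<delta> :: "'r \<Rightarrow> ('r \<Rightarrow>\<^sub>0 nat)" where "\<delta> = (\<lambda>k. Poly_Mapping.single k 1)"
  define p where "p = (\<Sum>k\<in>UNIV. Poly_Mapping.single (\<delta> k) (c k))"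
  have \<delta>_inj: "\<delta> k = \<delta> l \<longleftrightarrow> k = l" for k l
    unfolding \<delta>_def by (metis lookup_single_eq lookup_single_not_eq zero_neq_one)
  have mono: "mono_eval (\<delta> k) y = y $ k" for k y
    unfolding mono_eval_def \<delta>_def
    by (subst prod.mono_neutral_right[of UNIV "{k}"]) (auto simp: lookup_single_not_eq)
  have wt: "mweight v (\<delta> k) = v $ k" for k
    unfolding mweight_def \<delta>_def
    by (subst sum.mono_neutral_right[of UNIV "{k}"]) (auto simp: lookup_single_not_eq)
  have lk: "Poly_Mapping.lookup p (\<delta> k) = c k" for k
    by (simp add: p_def lookup_sum lookup_single when_def \<delta>_inj)
  have "Poly_Mapping.keys p \<subseteq> (\<Union>k. Poly_Mapping.keys (Poly_Mapping.single (\<delta> k) (c k)))"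
    unfolding p_def by (rule keys_sum)
  then have keys: "\<exists>k. \<beta> = \<delta> k \<and> c k \<noteq> 0" if "\<beta> \<in> Poly_Mapping.keys p" for \<beta>
    using that by (auto split: if_splits)
  have "v \<notin> tropicalization (range (\<lambda>x. U *v x))"
  proof (rule not_in_tropicalization)
    show "p \<in> vanishing_ideal (range (\<lambda>x. U *v x))"
      by (auto simp: vanishing_ideal_def p_def peval_sum peval_single mono relation_apply rel)
    show "\<delta> j \<in> Poly_Mapping.keys p" using lk \<open>c j \<noteq> 0\<close> by (simp add: in_keys_iff)
    show "mweight v (\<delta> j) < mweight v \<beta>" if "\<beta> \<in> Poly_Mapping.keys p" "\<beta> \<noteq> \<delta> j" for \<beta>
      using keys[OF that(1)] that(2) no by (auto simp: wt not_le)
  qed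
  then show False using assms by blast
qed

section \<open>Paths with prescribed orders\<close>

text \<open>A point good for \<open>J\<close> is moved along a coordinate \<open>b0\<close> on which
  the new form depends; each form excludes only finitely many shifts \<epsilon>.\<close>

lemma generic_nonvanishing:
  fixes a :: "'j \<Rightarrow> 'r::finite \<Rightarrow> 'a::field"
  assumes inf: "infinite (UNIV :: 'a set)" and "finite J" "\<And>j. j \<in> J \<Longrightarrow> \<exists>b. a j b \<noteq> 0"
  shows "\<exists>s. \<forall>j\<in>J. (\<Sum>b\<in>UNIV. a j b * s b) \<noteq> 0"
  using assms(2,3)
proof (induction J rule: finite_induct)
  case empty
  then show ?case by auto
next
  case (insert j J)
  then obtain s where s: "\<And>i. i \<in> J \<Longrightarrow> (\<Sum>b\<in>UNIV. a i b * s b) \<noteq> 0" by auto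
  obtain b0 where b0: "a j b0 \<noteq> 0" using insert.prems by blast
  let ?S = "\<lambda>i. \<Sum>b\<in>UNIV. a i b * s b"
  have fin: "finite {\<epsilon>. ?S i + \<epsilon> * a i b0 = 0}" if "i \<in> insert j J" for i
  proof (cases "a i b0 = 0")
    \<comment> \<open>Then \<open>i\<close> is not \<open>j\<close>, and the shift leaves its
      non-zero value unchanged, so no \<epsilon> is excluded.\<close>
    case True
    then show ?thesis using that b0 s by auto
  next
    case False
    then have "{\<epsilon>. ?S i + \<epsilon> * a i b0 = 0} \<subseteq> {- ?S i / a i b0}"
      by (auto simp: field_simps eq_neg_iff_add_eq_0)
    then show ?thesis by (rule finite_subset) simp
  qed
  then have "finite (\<Union>i\<in>insert j J. {\<epsilon>. ?S i + \<epsilon> * a i b0 = 0})"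
    using insert.hyps(1) by blast
  then obtain \<epsilon> where \<epsilon>: "\<epsilon> \<notin> (\<Union>i\<in>insert j J. {\<epsilon>. ?S i + \<epsilon> * a i b0 = 0})"
    using inf ex_new_if_finite by blast
  have "(\<Sum>b\<in>UNIV. a i b * (s b + (if b = b0 then \<epsilon> else 0))) = ?S i + \<epsilon> * a i b0" for i
    by (simp add: distrib_left sum.distrib if_distrib[of "\<lambda>c. _ * c"] mult.commute cong: if_cong)
  then show ?case using \<epsilon> by (intro exI[of _ "\<lambda>b. s b + (if b = b0 then \<epsilon> else 0)"]) auto
qed

text \<open>Values on independent rows extend to a linear functional. Independence is stated for
  indexed families, so equal rows at different indices count as dependent.\<close>

lemma ex_prescribed_coordinates:
  fixes U :: "complex^'m::finite^'r::finite"
  assumes indep: "\<And>c b. (\<And>b. c b \<noteq> 0 \<Longrightarrow> b \<in> B) \<Longrightarrow> (\<Sum>b\<in>UNIV. c b *s U $ b) = 0 \<Longrightarrow> c b = 0"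
  shows "\<exists>x. \<forall>b\<in>B. (U *v x) $ b = s b"
proof -
  have inj: "inj_on (($) U) B"
  proof (rule inj_onI, rule ccontr)
    fix b b' assume b: "b \<in> B" "b' \<in> B" "U $ b = U $ b'" "b \<noteq> b'"
    define c :: "'r \<Rightarrow> complex" where "c = (\<lambda>k. if k = b then 1 else if k = b' then -1 else 0)"
    have "(\<Sum>k\<in>UNIV. c k *s U $ k) = (\<Sum>k\<in>{b, b'}. c k *s U $ k)"
      by (intro sum.mono_neutral_right) (auto simp: c_def)
    also have "\<dots> = 0" using b by (simp add: c_def)
    finally have "c b = 0" using b by (intro indep) (auto simp: c_def split: if_splits)
    then show False by (simp add: c_def)
  qed
  have "vec.independent (($) U ` B)"
    unfolding vec.dependent_finite[OF finite_imageI[OF finite]]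
  proof (rule notI, elim exE conjE bexE imageE)
    fix u y b assume "(\<Sum>v\<in>($) U ` B. u v *s v) = 0" "b \<in> B" "u y \<noteq> 0" "y = U $ b"
    then have "(\<Sum>b\<in>B. u (U $ b) *s U $ b) = 0" by (simp add: sum.reindex[OF inj])
    moreover have "(\<Sum>b\<in>UNIV. (if b \<in> B then u (U $ b) else 0) *s U $ b) = (\<Sum>b\<in>B. u (U $ b) *s U $ b)"
      by (intro sum.mono_neutral_cong_right) auto
    ultimately have "(if b \<in> B then u (U $ b) else 0) = 0"
      by (intro indep[of "\<lambda>b. if b \<in> B then u (U $ b) else 0"]) (auto split: if_splits)
    then show False using \<open>b \<in> B\<close> \<open>u y \<noteq> 0\<close> \<open>y = U $ b\<close> by simp
  qed
  \<comment> \<open>The functional is packed into an endomorphism sending row \<open>b\<close> to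
    the constant vector \<open>s b\<close>. Any row of its matrix, here the one at
    \<open>undefined\<close>, serves as \<open>x\<close>.\<close>
  from vec.linear_independent_extend[OF this, of "\<lambda>y. (\<chi> _. s (inv_into B (($) U) y)) :: complex^'m"]
  obtain g :: "complex^'m \<Rightarrow> complex^'m" where g: "Vector_Spaces.linear (*s) (*s) g"
    "\<And>b. b \<in> B \<Longrightarrow> g (U $ b) = (\<chi> _. s b)" using inj by auto
  have "(U *v (matrix g $ undefined)) $ b = (matrix g *v (U $ b)) $ undefined" for b
    by (simp add: matrix_vector_mult_def mult.commute)
  then show ?thesis using g by (auto simp: matrix_works intro!: exI[of _ "matrix g $ undefined"])
qed

lemma ex_adapted_basis:
  fixes U :: "complex^'m::finite^'r::finite" and v :: "real^'r"
  obtains B where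
    "\<And>j. \<exists>c. (\<forall>b. c b \<noteq> 0 \<longrightarrow> b \<in> B \<and> v $ j \<le> v $ b) \<and> U $ j = (\<Sum>b\<in>UNIV. c b *s U $ b)"
    "\<And>c b. (\<And>b. c b \<noteq> 0 \<Longrightarrow> b \<in> B) \<Longrightarrow> (\<Sum>b\<in>UNIV. c b *s U $ b) = 0 \<Longrightarrow> c b = 0"
proof -
  define \<Phi> where "\<Phi> = (\<lambda>B. \<forall>j. \<exists>c. (\<forall>b. c b \<noteq> 0 \<longrightarrow> b \<in> B \<and> v $ j \<le> v $ b)
     \<and> U $ j = (\<Sum>b\<in>UNIV. c b *s U $ b))"
  have unit: "U $ j = (\<Sum>b\<in>UNIV. (if b = j then 1 else 0) *s U $ b)" for j
    by (simp add: if_distrib[of "\<lambda>c. c *s _"] cong: if_cong)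
  have "\<Phi> UNIV" unfolding \<Phi>_def
  proof
    fix j
    show "\<exists>c. (\<forall>b. c b \<noteq> 0 \<longrightarrow> b \<in> UNIV \<and> v $ j \<le> v $ b) \<and> U $ j = (\<Sum>b\<in>UNIV. c b *s U $ b)"
      by (rule exI[of _ "\<lambda>b. if b = j then 1 else 0"], intro conjI unit) auto
  qed
  then obtain B where B: "\<Phi> B" and min: "\<And>B'. \<Phi> B' \<Longrightarrow> card B \<le> card B'"
    using ex_has_least_nat[of \<Phi> UNIV card] by blast
  have "c b = 0" if supp: "\<And>b. c b \<noteq> 0 \<Longrightarrow> b \<in> B" and rel: "(\<Sum>b\<in>UNIV. c b *s U $ b) = 0" for c b
  proof (rule ccontr)
    assume "c b \<noteq> 0"
    define C where "C = {b. c b \<noteq> 0}"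
    have "C \<noteq> {}" "finite C" using \<open>c b \<noteq> 0\<close> by (auto simp: C_def)
    then obtain b0 where b0: "c b0 \<noteq> 0" "\<And>b. c b \<noteq> 0 \<Longrightarrow> v $ b0 \<le> v $ b"
      using ex_min_if_finite[of "($) v ` C"] by (auto simp: C_def not_less)
    define f where "f = (\<lambda>b. if b = b0 then 0 else - c b / c b0)"
    have "0 = c b0 *s U $ b0 + (\<Sum>b\<in>UNIV-{b0}. c b *s U $ b)"
      using rel by (simp add: sum.remove[of _ b0])
    also have "(\<Sum>b\<in>UNIV-{b0}. c b *s U $ b) = - c b0 *s (\<Sum>b\<in>UNIV-{b0}. f b *s U $ b)"
      unfolding vec.scale_sum_right using b0(1) by (intro sum.cong) (auto simp: f_def)
    also have "(\<Sum>b\<in>UNIV-{b0}. f b *s U $ b) = (\<Sum>b\<in>UNIV. f b *s U $ b)"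
      by (intro sum.mono_neutral_left) (auto simp: f_def)
    finally have "c b0 *s U $ b0 = c b0 *s (\<Sum>b\<in>UNIV. f b *s U $ b)" by simp
    then have f: "U $ b0 = (\<Sum>b\<in>UNIV. f b *s U $ b)" using b0(1) by (simp add: vec.scale_cancel_left)
    have "\<Phi> (B - {b0})" unfolding \<Phi>_def
    proof
      fix j
      obtain e where e: "\<And>b. e b \<noteq> 0 \<Longrightarrow> b \<in> B \<and> v $ j \<le> v $ b" "U $ j = (\<Sum>b\<in>UNIV. e b *s U $ b)"
        using B unfolding \<Phi>_def by blast
      define h where "h = (\<lambda>b. (if b = b0 then 0 else e b) + e b0 * f b)"
      have "(\<Sum>b\<in>UNIV. h b *s U $ b) = (\<Sum>b\<in>UNIV. (if b = b0 then 0 else e b) *s U $ b) + e b0 *s U $ b0"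
        unfolding h_def by (simp add: vec.scale_left_distrib sum.distrib)
           (subst f, simp add: vec.scale_sum_right)
      also have "(\<Sum>b\<in>UNIV. (if b = b0 then 0 else e b) *s U $ b) = (\<Sum>b\<in>UNIV-{b0}. e b *s U $ b)"
        by (intro sum.mono_neutral_cong_right) auto
      also have "\<dots> + e b0 *s U $ b0 = U $ j"
        unfolding e(2) by (simp add: sum.remove[of UNIV b0])
      finally have "U $ j = (\<Sum>b\<in>UNIV. h b *s U $ b)" by simp
      moreover have "b \<in> B - {b0} \<and> v $ j \<le> v $ b" if "h b \<noteq> 0" for b
      proof -
        have "b \<noteq> b0" using that by (auto simp: h_def f_def)
        \<comment> \<open>A coefficient introduced by replacing \<open>b0\<close> needs
          \<open>e b0 \<noteq> 0\<close>, and then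
          \<open>v $ j \<le> v $ b0 \<le> v $ b\<close>.\<close>
        moreover from this have "e b \<noteq> 0 \<or> (e b0 \<noteq> 0 \<and> c b \<noteq> 0)" using that by (auto simp: h_def f_def)
        then have "b \<in> B \<and> v $ j \<le> v $ b" using e(1) supp b0(2)[of b] by force
        ultimately show ?thesis by blast
      qed
      ultimately show "\<exists>c. (\<forall>b. c b \<noteq> 0 \<longrightarrow> b \<in> B - {b0} \<and> v $ j \<le> v $ b) \<and> U $ j = (\<Sum>b\<in>UNIV. c b *s U $ b)"
        by blast
    qed
    from min[OF this] show False using supp[OF b0(1)] by (metis card_Diff1_less finite leD)
  qed
  then show ?thesis using that B unfolding \<Phi>_def by blast
qed

text \<open>On the adapted basis the coordinates are set to \<open>s b * t powr (v $ b)\<close>.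
  Every other coordinate \<open>j\<close> then has order at least \<open>v $ j\<close>; balancedness
  and a generic \<open>s\<close> make the order exact.\<close>

lemma balanced_imp_tropical_limit:
  fixes U :: "complex^'m::finite^'r::finite"
  assumes "balanced U v"
  obtains x d where "tropical_limit (\<lambda>t. U *v x t) v d"
proof -
  obtain B where span: "\<And>j. \<exists>c. (\<forall>b. c b \<noteq> 0 \<longrightarrow> b \<in> B \<and> v $ j \<le> v $ b) \<and> U $ j = (\<Sum>b\<in>UNIV. c b *s U $ b)"
    and indep: "\<And>c b. (\<And>b. c b \<noteq> 0 \<Longrightarrow> b \<in> B) \<Longrightarrow> (\<Sum>b\<in>UNIV. c b *s U $ b) = 0 \<Longrightarrow> c b = 0"
    by (rule ex_adapted_basis[where U = U and v = v]) blast
  obtain c where c: "\<And>j b. c j b \<noteq> 0 \<Longrightarrow> b \<in> B \<and> v $ j \<le> v $ b"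
    "\<And>j. U $ j = (\<Sum>b\<in>UNIV. c j b *s U $ b)" using span by metis
  \<comment> \<open>The part of the expansion of row \<open>j\<close> that contributes to the power
    \<open>t powr (v $ j)\<close>.\<close>
  define a where "a = (\<lambda>j b. if v $ b = v $ j then c j b else 0)"
  have "\<exists>b. a j b \<noteq> 0" for j
  proof (rule ccontr)
    assume no: "\<not> ?thesis"
    have "(\<Sum>b\<in>UNIV. ((if b = j then 1 else 0) - c j b) *s U $ b) = U $ j - (\<Sum>b\<in>UNIV. c j b *s U $ b)"
      by (simp add: vec.scale_left_diff_distrib sum_subtractf if_distrib[of "\<lambda>c. c *s _"] cong: if_cong)
    also have "\<dots> = 0" using c(2)[of j] by simp
    finally have rel: "(\<Sum>b\<in>UNIV. ((if b = j then 1 else 0) - c j b) *s U $ b) = 0" .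
    \<comment> \<open>In the relation just found, row \<open>j\<close> has coefficient
      \<open>1 - c j j\<close>, which must be non-zero before balancedness applies.\<close>
    have "c j j = a j j" by (simp add: a_def)
    then have "c j j = 0" using no by auto
    then obtain k where "k \<noteq> j" "c j k \<noteq> 0" "v $ k \<le> v $ j"
      using assms[unfolded balanced_def, rule_format, OF rel, of j] by auto
    then have "a j k \<noteq> 0" using c(1)[of j k] by (simp add: a_def)
    then show False using no by blast
  qed
  then obtain s where s: "\<And>j. (\<Sum>b\<in>UNIV. a j b * s b) \<noteq> 0"
    using generic_nonvanishing[of UNIV a] infinite_UNIV_char_0 by auto
  have "\<forall>t. \<exists>x. \<forall>b\<in>B. (U *v x) $ b = s b * of_real (t powr (v $ b))"
    by (intro allI ex_prescribed_coordinates) (rule indep)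
  then obtain x where x: "\<And>t b. b \<in> B \<Longrightarrow> (U *v x t) $ b = s b * of_real (t powr (v $ b))" by metis
  have coord: "(U *v x t) $ j = (\<Sum>b\<in>UNIV. c j b * (s b * of_real (t powr (v $ b))))" for t j
  proof -
    have "(U *v x t) $ j = (\<Sum>i\<in>UNIV. (\<Sum>b\<in>UNIV. c j b *s U $ b) $ i * x t $ i)"
      by (subst c(2)[symmetric]) (simp add: matrix_vector_mult_def)
    also have "\<dots> = (\<Sum>b\<in>UNIV. c j b * (U *v x t) $ b)" by (simp only: relation_apply)
    also have "\<dots> = (\<Sum>b\<in>UNIV. c j b * (s b * of_real (t powr (v $ b))))"
      using c(1)[of j] x by (intro sum.cong) auto
    finally show ?thesis .
  qed
  have "((\<lambda>t. (U *v x t) $ j * of_real (t powr (- (v $ j)))) \<longlongrightarrow> (\<Sum>b\<in>UNIV. a j b * s b)) (at_right 0)" for j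
  proof -
    have "((\<lambda>t. c j b * (s b * of_real (t powr (v $ b))) * of_real (t powr (- (v $ j)))) \<longlongrightarrow> a j b * s b) (at_right 0)" for b
    proof (cases "c j b = 0")
      case True
      then show ?thesis by (simp add: a_def)
    next
      case False
      have l1: "((\<lambda>t. c j b * s b * of_real (t powr (v $ b - v $ j))) \<longlongrightarrow> c j b * s b * (if v $ b - v $ j = 0 then 1 else 0)) (at_right 0)"
        using c(1)[OF False] by (intro tendsto_mult tendsto_const tendsto_powr_at_right_0) auto
      have l2: "eventually (\<lambda>t. c j b * s b * of_real (t powr (v $ b - v $ j))
          = c j b * (s b * of_real (t powr (v $ b))) * of_real (t powr (- (v $ j)))) (at_right 0)"
        using eventually_pos_at_right by (rule eventually_mono) (simp add: mult.assoc flip: of_real_mult powr_add)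
      have "c j b * s b * (if v $ b - v $ j = 0 then 1 else 0) = a j b * s b" by (simp add: a_def)
      then show ?thesis using Lim_transform_eventually[OF l1 l2] by (simp only:)
    qed
    then show ?thesis unfolding coord sum_distrib_right by (intro tendsto_sum)
  qed
  then have "tropical_limit (\<lambda>t. U *v x t) v (\<chi> j. \<Sum>b\<in>UNIV. a j b * s b)"
    using s by (simp add: tropical_limit_def)
  then show ?thesis by (rule that)
qed

lemma balanced_imp_tropicalization:
  fixes U :: "complex^'m::finite^'r::finite"
  assumes "balanced U v" shows "v \<in> tropicalization (range (\<lambda>x. U *v x))"
proof -
  obtain x d where "tropical_limit (\<lambda>t. U *v x t) v d" using assms by (rule balanced_imp_tropical_limit)
  then show ?thesis by (intro in_tropicalizationI[of "\<lambda>t. U *v x t"]) auto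
qed

lemma balanced_imp_tropicalization_Y_UV:
  fixes U :: "complex^'m::finite^'r::finite" and V :: "int^'r^'s::finite"
  assumes "balanced U v"
  shows "(\<chi> i k. real_of_int (V $ i $ k)) *v v \<in> tropicalization (Y_UV U V)"
proof -
  obtain x d where lim: "tropical_limit (\<lambda>t. U *v x t) v d" using assms by (rule balanced_imp_tropical_limit)
  have "eventually (\<lambda>t. x t \<in> map_domain U) (at_right 0)"
    using tropical_limit_eventually_nonzero[OF lim] by (simp add: map_domain_def)
  then have "eventually (\<lambda>t. monomial_map U V (x t) \<in> Y_UV U V) (at_right 0)"
    unfolding Y_UV_def by (rule eventually_mono) (use subset_zariski_closure in fast)
  then show ?thesis using tropical_limit_monomial_map[OF lim] by (rule in_tropicalizationI)
qed

section \<open>Lifting tropical points\<close>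

lemma sum_apply_fun: "(\<Sum>i\<in>I. f i) x = (\<Sum>i\<in>I. f i x)" for f :: "'i \<Rightarrow> 'a \<Rightarrow> 'b::comm_monoid_add"
  by (induction I rule: infinite_finite_induct) auto

lemma power_int_sum:
  fixes x :: "'a::field" assumes "x \<noteq> 0"
  shows "x powi (\<Sum>i\<in>I. f i) = (\<Prod>i\<in>I. x powi f i)"
  by (induction I rule: infinite_finite_induct) (use assms in \<open>auto simp: power_int_add\<close>)

lemma prod_power_int:
  fixes f :: "'i \<Rightarrow> 'a::field"
  shows "(\<Prod>i\<in>I. f i) powi n = (\<Prod>i\<in>I. f i powi n)"
  by (induction I rule: infinite_finite_induct) (auto simp: power_int_mult_distrib)

text \<open>Membership depends only on the values on \<open>D\<close>: the rule \<open>zero\<close>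
  admits every function vanishing there, which amounts to computing modulo such functions.\<close>

inductive_set posring :: "('a \<Rightarrow> complex^'s::finite) \<Rightarrow> 'a set \<Rightarrow> real^'s \<Rightarrow> ('a \<Rightarrow> complex) set"
  for \<phi> D w where
  zero: "(\<And>x. x \<in> D \<Longrightarrow> h x = 0) \<Longrightarrow> h \<in> posring \<phi> D w"
| mono: "(\<And>x. x \<in> D \<Longrightarrow> h x = c * (\<Prod>i\<in>UNIV. \<phi> x $ i powi u i)) \<Longrightarrow>
     0 < (\<Sum>i\<in>UNIV. w $ i * of_int (u i)) \<Longrightarrow> h \<in> posring \<phi> D w"
| add: "g \<in> posring \<phi> D w \<Longrightarrow> h \<in> posring \<phi> D w \<Longrightarrow> (\<lambda>x. g x + h x) \<in> posring \<phi> D w"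

lemma posring_scale:
  assumes "h \<in> posring \<phi> D w" shows "(\<lambda>x. c * h x) \<in> posring \<phi> D w"
  using assms
proof induction
  case (mono h c' u)
  then show ?case by (intro posring.mono[of D _ "c * c'" \<phi> u]) auto
qed (auto simp: distrib_left intro: posring.zero posring.add)

lemma posring_mult:
  assumes nz: "\<And>x i. x \<in> D \<Longrightarrow> \<phi> x $ i \<noteq> 0" and "g \<in> posring \<phi> D w" "h \<in> posring \<phi> D w"
  shows "(\<lambda>x. g x * h x) \<in> posring \<phi> D w"
  using assms(2)
proof induction
  case (mono g c u)
  note g = mono
  show ?case using assms(3)
  proof induction
    case (zero h)
    then show ?case by (intro posring.zero) auto
  next
    case (mono h c' u')
    have "g x * h x = c * c' * (\<Prod>i\<in>UNIV. \<phi> x $ i powi (u i + u' i))" if "x \<in> D" for x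
      using g(1)[OF that] mono(1)[OF that] nz[OF that] by (simp add: power_int_add prod.distrib)
    moreover have "0 < (\<Sum>i\<in>UNIV. w $ i * of_int (u i + u' i))"
      using g(2) mono(2) by (simp add: distrib_left sum.distrib)
    ultimately show ?case by (rule posring.mono)
  next
    case (add h h')
    then show ?case using posring.add by (fastforce simp: distrib_left)
  qed
next
  case (zero g)
  then show ?case by (intro posring.zero) auto
next
  case (add g g')
  then show ?case using posring.add by (fastforce simp: distrib_right)
qed

text \<open>Over a finite index type every function has finite support, so
  \<open>Abs_poly_mapping\<close> may be applied to any exponent function.\<close>

definition expo :: "('s::finite \<Rightarrow> nat) \<Rightarrow> ('s \<Rightarrow>\<^sub>0 nat)" where
  "expo f = Abs_poly_mapping f"

lemma lookup_expo: "Poly_Mapping.lookup (expo f) = f"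
  by (simp add: expo_def Abs_poly_mapping_inverse)

text \<open>A high power of the product of all coordinates clears the denominators. The claim covers
  all large \<open>N\<close> so that two summands can share one exponent.\<close>

lemma posring_polynomial:
  assumes nz: "\<And>x i. x \<in> D \<Longrightarrow> \<phi> x $ i \<noteq> 0" and "h \<in> posring \<phi> D w"
  shows "\<exists>N0. \<forall>N\<ge>N0. \<exists>p. (\<forall>\<alpha>\<in>Poly_Mapping.keys p. mweight w (expo (\<lambda>_. N)) < mweight w \<alpha>) \<and>
     (\<forall>x\<in>D. peval p (\<phi> x) = h x * mono_eval (expo (\<lambda>_. N)) (\<phi> x))"
  using assms(2)
proof induction
  case (zero h)
  then show ?case by (intro exI[of _ 0] allI impI exI[of _ 0]) (auto simp: peval_zero)
next
  case (mono h c u)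
  define N0 where "N0 = (\<Sum>i\<in>UNIV. nat \<bar>u i\<bar>)"
  have "\<exists>p. (\<forall>\<alpha>\<in>Poly_Mapping.keys p. mweight w (expo (\<lambda>_. N)) < mweight w \<alpha>) \<and>
     (\<forall>x\<in>D. peval p (\<phi> x) = h x * mono_eval (expo (\<lambda>_. N)) (\<phi> x))" if "N0 \<le> N" for N
  proof -
    have nonneg: "0 \<le> int N + u i" for i
    proof -
      have "nat \<bar>u i\<bar> \<le> N0" unfolding N0_def by (rule member_le_sum) auto
      then show ?thesis using that by linarith
    qed
    define \<alpha> where "\<alpha> = expo (\<lambda>i. nat (int N + u i))"
    have "mweight w \<alpha> = mweight w (expo (\<lambda>_. N)) + (\<Sum>i\<in>UNIV. w $ i * of_int (u i))"
      using nonneg by (simp add: mweight_def \<alpha>_def lookup_expo of_nat_nat distrib_left sum.distrib)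
    then have "mweight w (expo (\<lambda>_. N)) < mweight w \<alpha>" using mono(2) by simp
    moreover have "peval (Poly_Mapping.single \<alpha> c) (\<phi> x) = h x * mono_eval (expo (\<lambda>_. N)) (\<phi> x)"
      if x: "x \<in> D" for x
    proof -
      have "\<phi> x $ i ^ nat (int N + u i) = \<phi> x $ i powi u i * \<phi> x $ i ^ N" for i
        using nz[OF x, of i] nonneg[of i] power_int_add[of "\<phi> x $ i" "u i" "int N"]
        by (simp add: power_int_def add.commute split: if_splits)
      then show ?thesis
        by (simp add: peval_single mono(1)[OF x] mono_eval_def \<alpha>_def lookup_expo prod.distrib)
    qed
    ultimately show ?thesis
      by (intro exI[of _ "Poly_Mapping.single \<alpha> c"]) auto
  qed
  then show ?case by blast
next
  case (add g h)
  then obtain N1 N2 where N1: "\<forall>N\<ge>N1. \<exists>p. (\<forall>\<alpha>\<in>Poly_Mapping.keys p. mweight w (expo (\<lambda>_. N)) < mweight w \<alpha>) \<and>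
     (\<forall>x\<in>D. peval p (\<phi> x) = g x * mono_eval (expo (\<lambda>_. N)) (\<phi> x))"
   and N2: "\<forall>N\<ge>N2. \<exists>p. (\<forall>\<alpha>\<in>Poly_Mapping.keys p. mweight w (expo (\<lambda>_. N)) < mweight w \<alpha>) \<and>
     (\<forall>x\<in>D. peval p (\<phi> x) = h x * mono_eval (expo (\<lambda>_. N)) (\<phi> x))" by blast
  show ?case
  proof (intro exI[of _ "max N1 N2"] allI impI)
    fix N assume "max N1 N2 \<le> N"
    then have "N1 \<le> N" "N2 \<le> N" by auto
    obtain p where "\<forall>\<alpha>\<in>Poly_Mapping.keys p. mweight w (expo (\<lambda>_. N)) < mweight w \<alpha>"
      "\<forall>x\<in>D. peval p (\<phi> x) = g x * mono_eval (expo (\<lambda>_. N)) (\<phi> x)"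
      using N1[rule_format, OF \<open>N1 \<le> N\<close>] by blast
    moreover obtain q where "\<forall>\<alpha>\<in>Poly_Mapping.keys q. mweight w (expo (\<lambda>_. N)) < mweight w \<alpha>"
      "\<forall>x\<in>D. peval q (\<phi> x) = h x * mono_eval (expo (\<lambda>_. N)) (\<phi> x)"
      using N2[rule_format, OF \<open>N2 \<le> N\<close>] by blast
    ultimately show "\<exists>p. (\<forall>\<alpha>\<in>Poly_Mapping.keys p. mweight w (expo (\<lambda>_. N)) < mweight w \<alpha>) \<and>
     (\<forall>x\<in>D. peval p (\<phi> x) = (g x + h x) * mono_eval (expo (\<lambda>_. N)) (\<phi> x))"
      using keys_add[of p q] by (intro exI[of _ "p + q"]) (auto simp: peval_add distrib_right)
  qed
qed

text \<open>Otherwise, after clearing denominators, a monomial would agree on the image with a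
  polynomial of strictly larger weights; the difference has a unique lowest term.\<close>

lemma one_notin_posring:
  assumes nz: "\<And>x i. x \<in> D \<Longrightarrow> \<phi> x $ i \<noteq> 0" and w: "w \<in> tropicalization (zariski_closure (\<phi> ` D))"
  shows "1 \<notin> posring \<phi> D w"
proof
  assume "1 \<in> posring \<phi> D w"
  from posring_polynomial[OF nz this] obtain N p
    where p: "\<And>\<alpha>. \<alpha> \<in> Poly_Mapping.keys p \<Longrightarrow> mweight w (expo (\<lambda>_. N)) < mweight w \<alpha>"
      "\<And>x. x \<in> D \<Longrightarrow> peval p (\<phi> x) = mono_eval (expo (\<lambda>_. N)) (\<phi> x)" by fastforce
  let ?\<alpha> = "expo (\<lambda>_::'b. N)"
  let ?q = "Poly_Mapping.single ?\<alpha> 1 + Poly_Mapping.single 0 (-1) * p"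
  have eval: "peval ?q y = mono_eval ?\<alpha> y - peval p y" for y
    by (simp add: peval_add peval_mult peval_single) (simp add: mono_eval_def)
  have lk: "Poly_Mapping.lookup ?q \<beta> = (if \<beta> = ?\<alpha> then 1 else 0) - Poly_Mapping.lookup p \<beta>" for \<beta>
    by (auto simp: lookup_add lookup_minus lookup_single when_def single_uminus)
  have "w \<notin> tropicalization (zariski_closure (\<phi> ` D))"
  proof (rule not_in_tropicalization)
    show "?q \<in> vanishing_ideal (zariski_closure (\<phi> ` D))"
      unfolding vanishing_ideal_zariski_closure using p(2) by (auto simp: vanishing_ideal_def eval)
    have "?\<alpha> \<notin> Poly_Mapping.keys p" using p(1) by blast
    then show "?\<alpha> \<in> Poly_Mapping.keys ?q" using lk[of ?\<alpha>] by (simp add: in_keys_iff)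
    show "mweight w ?\<alpha> < mweight w \<beta>" if "\<beta> \<in> Poly_Mapping.keys ?q" "\<beta> \<noteq> ?\<alpha>" for \<beta>
      using that lk[of \<beta>] by (intro p(1)) (auto simp: in_keys_iff)
  qed
  then show False using w by blast
qed

lemma subrng_posring:
  assumes "\<And>x i. x \<in> D \<Longrightarrow> \<phi> x $ i \<noteq> 0"
  shows "subrng (range (\<lambda>c _. c)) (posring \<phi> D w)"
  unfolding subrng_def func_plus func_times
  using posring_mult[where \<phi> = \<phi> and D = D and w = w, OF assms]
  by (auto intro: posring.zero posring.add posring_scale)

text \<open>\<open>P\<close> stands for the exponents of non-negative order in a possibly
  non-archimedean sense. Only the finitely many constraints in \<open>S\<close> are realised by a
  real vector.\<close>

lemma ex_real_point_of_order:
  fixes V :: "int^'r::finite^'s::finite" and w :: "real^'s" and P :: "('r \<Rightarrow> int) set"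
  assumes P_0: "(\<lambda>_. 0) \<in> P" and P_add: "\<And>e f. e \<in> P \<Longrightarrow> f \<in> P \<Longrightarrow> (\<lambda>k. e k + f k) \<in> P"
    and "finite S" "S \<subseteq> P"
    and pos: "\<And>u. 0 < (\<Sum>i\<in>UNIV. w $ i * of_int (u i)) \<Longrightarrow> (\<lambda>k. - (\<Sum>i\<in>UNIV. u i * V $ i $ k)) \<notin> P"
  shows "\<exists>v. (\<forall>e\<in>S. 0 \<le> (\<Sum>k\<in>UNIV. of_int (e k) * v k)) \<and>
     (\<forall>i. w $ i = (\<Sum>k\<in>UNIV. of_int (V $ i $ k) * v k))"
proof -
  define G where "G = {(e, \<beta>). \<exists>u. \<beta> = (\<Sum>i\<in>UNIV. w $ i * of_int (u i)) \<and>
     (\<lambda>k. e k + (- (\<Sum>i\<in>UNIV. u i * V $ i $ k))) \<in> P}"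
  define S1 where "S1 = (\<lambda>e. (e, 0 :: real)) ` S"
  \<comment> \<open>\<open>S2\<close> and \<open>S3\<close> are the two halves of the equation that
    \<open>V\<close> maps \<open>v\<close> to \<open>w\<close>.\<close>
  define S2 where "S2 = range (\<lambda>i. (\<lambda>l. V $ i $ l, w $ i))"
  define S3 where "S3 = range (\<lambda>i. (\<lambda>l. - V $ i $ l, - w $ i))"
  have "\<exists>v. \<forall>(e, \<beta>)\<in>S1 \<union> S2 \<union> S3. \<beta> \<le> (\<Sum>k\<in>UNIV. of_int (e k) * v k)"
  proof (rule integral_fourier_motzkin[where G = G])
    fix e f \<beta> \<gamma> assume "(e, \<beta>) \<in> G" "(f, \<gamma>) \<in> G"
    then obtain u u' where u: "\<beta> = (\<Sum>i\<in>UNIV. w $ i * of_int (u i))"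
      "(\<lambda>k. e k + (- (\<Sum>i\<in>UNIV. u i * V $ i $ k))) \<in> P"
      "\<gamma> = (\<Sum>i\<in>UNIV. w $ i * of_int (u' i))"
      "(\<lambda>k. f k + (- (\<Sum>i\<in>UNIV. u' i * V $ i $ k))) \<in> P" by (auto simp: G_def)
    have "(\<lambda>k. e k + f k + (- (\<Sum>i\<in>UNIV. (u i + u' i) * V $ i $ k)))
      = (\<lambda>k. (e k + (- (\<Sum>i\<in>UNIV. u i * V $ i $ k))) + (f k + (- (\<Sum>i\<in>UNIV. u' i * V $ i $ k))))"
      by (simp add: fun_eq_iff distrib_right sum.distrib)
    then have "(\<lambda>k. e k + f k + (- (\<Sum>i\<in>UNIV. (u i + u' i) * V $ i $ k))) \<in> P"
      using P_add[OF u(2,4)] by simp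
    moreover have "\<beta> + \<gamma> = (\<Sum>i\<in>UNIV. w $ i * of_int (u i + u' i))"
      using u by (simp add: distrib_left sum.distrib)
    ultimately show "(\<lambda>k. e k + f k, \<beta> + \<gamma>) \<in> G"
      unfolding G_def by (auto intro!: exI[of _ "\<lambda>i. u i + u' i"])
  next
    fix \<beta> assume "(\<lambda>_. 0, \<beta>) \<in> G"
    then obtain u where "\<beta> = (\<Sum>i\<in>UNIV. w $ i * of_int (u i))"
      "(\<lambda>k. - (\<Sum>i\<in>UNIV. u i * V $ i $ k)) \<in> P" by (auto simp: G_def)
    then show "\<beta> \<le> 0" using pos[of u] by force
  next
    show "finite (S1 \<union> S2 \<union> S3)" using \<open>finite S\<close> by (simp add: S1_def S2_def S3_def)
    have "S1 \<subseteq> G" using \<open>S \<subseteq> P\<close> by (auto simp: S1_def G_def intro!: exI[of _ "\<lambda>_. 0"])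
    moreover have "(\<lambda>l. V $ j $ l, w $ j) \<in> G" for j
      unfolding G_def
      by (auto simp: P_0 if_distrib[of real_of_int] if_distrib[of "\<lambda>c. _ * c"] if_distrib[of "\<lambda>c. c * _"]
          intro!: exI[of _ "\<lambda>i. if i = j then 1 else 0"] cong: if_cong)
    then have "S2 \<subseteq> G" by (auto simp: S2_def)
    moreover have "(\<lambda>l. - V $ j $ l, - w $ j) \<in> G" for j
      unfolding G_def
      by (auto simp: P_0 if_distrib[of real_of_int] if_distrib[of "\<lambda>c. _ * c"] if_distrib[of "\<lambda>c. c * _"]
          intro!: exI[of _ "\<lambda>i. if i = j then -1 else 0"] cong: if_cong)
    then have "S3 \<subseteq> G" by (auto simp: S3_def)
    ultimately show "S1 \<union> S2 \<union> S3 \<subseteq> G" by blast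
  qed auto
  then obtain v where v: "\<And>e \<beta>. (e, \<beta>) \<in> S1 \<union> S2 \<union> S3 \<Longrightarrow> \<beta> \<le> (\<Sum>k\<in>UNIV. of_int (e k) * v k)" by blast
  have "w $ i = (\<Sum>k\<in>UNIV. of_int (V $ i $ k) * v k)" for i
  proof (rule antisym)
    show "w $ i \<le> (\<Sum>k\<in>UNIV. of_int (V $ i $ k) * v k)"
      by (rule v) (auto simp: S2_def)
    have "- w $ i \<le> (\<Sum>k\<in>UNIV. of_int (- V $ i $ k) * v k)"
      by (rule v) (auto simp: S3_def)
    then show "(\<Sum>k\<in>UNIV. of_int (V $ i $ k) * v k) \<le> w $ i" by (simp add: sum_negf)
  qed
  moreover have "0 \<le> (\<Sum>k\<in>UNIV. of_int (e k) * v k)" if "e \<in> S" for e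
    by (rule v) (use that in \<open>auto simp: S1_def\<close>)
  ultimately show ?thesis by blast
qed

lemma tropicalization_Y_UV_lift:
  fixes U :: "complex^'m::finite^'r::finite" and V :: "int^'r^'s::finite"
  assumes w: "w \<in> tropicalization (Y_UV U V)"
  obtains v where "balanced U v" "w = (\<chi> i k. real_of_int (V $ i $ k)) *v v"
proof -
  define D where "D = map_domain U"
  let ?K = "range (\<lambda>c (_ :: complex^'m). c :: complex)"
  let ?P = "posring (monomial_map U V) D w"
  have nz: "monomial_map U V x $ i \<noteq> 0" if "x \<in> D" for x i
    using that by (simp add: monomial_map_def D_def map_domain_def)
  have "1 \<notin> ?P" using one_notin_posring[of D "monomial_map U V" w] nz w by (simp add: Y_UV_def D_def)
  moreover have "-1 \<in> ?K" by (auto intro!: image_eqI[of _ _ "-1"] simp: fun_eq_iff)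
  ultimately obtain M where "maximal_subrng ?K M" and PM: "?P \<subseteq> M"
    using ex_maximal_subrng[OF subrng_posring[of D "monomial_map U V" w, OF nz]] by blast
  then interpret maximal_subrng ?K M by simp
  \<comment> \<open>The value 1 outside \<open>D\<close> makes each linear form a unit among all
    functions, so \<open>Xm_inv\<close> holds everywhere.\<close>
  define X where "X = (\<lambda>k x. if x \<in> D then (U *v x) $ k else 1)"
  define Xm where "Xm = (\<lambda>(e :: 'r \<Rightarrow> int) x. \<Prod>k\<in>UNIV. X k x powi e k)"
  have X: "X k x \<noteq> 0" for k x by (simp add: X_def D_def map_domain_def)
  have Xm_add: "Xm (\<lambda>k. e k + f k) = Xm e * Xm f" for e f
    using X by (auto simp: fun_eq_iff Xm_def power_int_add prod.distrib)
  have Xm_0: "Xm (\<lambda>_. 0) = 1" by (auto simp: fun_eq_iff Xm_def)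
  have Xm_inv: "Xm e * Xm (\<lambda>k. - e k) = 1" for e
    by (simp add: Xm_add[symmetric] Xm_0)
  have in_M: "Xm (\<lambda>k. \<Sum>i\<in>UNIV. u i * V $ i $ k) \<in> M" if "0 < (\<Sum>i\<in>UNIV. w $ i * of_int (u i))" for u
  proof -
    have "Xm (\<lambda>k. \<Sum>i\<in>UNIV. u i * V $ i $ k) x = 1 * (\<Prod>i\<in>UNIV. monomial_map U V x $ i powi u i)"
      if x: "x \<in> D" for x
    proof -
      have "Xm (\<lambda>k. \<Sum>i\<in>UNIV. u i * V $ i $ k) x = (\<Prod>k\<in>UNIV. \<Prod>i\<in>UNIV. X k x powi (V $ i $ k * u i))"
        using X by (simp add: Xm_def power_int_sum mult.commute)
      also have "\<dots> = (\<Prod>i\<in>UNIV. \<Prod>k\<in>UNIV. X k x powi (V $ i $ k * u i))" by (rule prod.swap)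
      also have "\<dots> = (\<Prod>i\<in>UNIV. monomial_map U V x $ i powi u i)"
        using x by (simp add: X_def monomial_map_def power_int_mult prod_power_int)
      finally show ?thesis by simp
    qed
    then have "Xm (\<lambda>k. \<Sum>i\<in>UNIV. u i * V $ i $ k) \<in> ?P"
      using that by (intro posring.mono[where u = u and c = 1])
    then show ?thesis using PM by blast
  qed
  \<comment> \<open>The exponent vector of the ratio of the linear forms \<open>k\<close> and
    \<open>a\<close>. There are finitely many, as the elimination requires.\<close>
  let ?e = "\<lambda>k a l. (if l = k then 1 else 0) - (if l = a then 1 else 0) :: int"
  have "\<exists>v. (\<forall>e\<in>{e \<in> range (\<lambda>(k, a). ?e k a). Xm e \<in> stab}. 0 \<le> (\<Sum>k\<in>UNIV. of_int (e k) * v k)) \<and>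
     (\<forall>i. w $ i = (\<Sum>k\<in>UNIV. of_int (V $ i $ k) * v k))"
  proof (rule ex_real_point_of_order[where P = "{e. Xm e \<in> stab}"])
    show "(\<lambda>k. - (\<Sum>i\<in>UNIV. u i * V $ i $ k)) \<notin> {e. Xm e \<in> stab}"
      if "0 < (\<Sum>i\<in>UNIV. w $ i * of_int (u i))" for u
    proof
      let ?f = "\<lambda>k. \<Sum>i\<in>UNIV. u i * V $ i $ k"
      assume "(\<lambda>k. - ?f k) \<in> {e. Xm e \<in> stab}"
      \<comment> \<open>A monomial of positive weight lies in \<open>M\<close>; its inverse in
        \<open>stab\<close> would bring 1 into \<open>M\<close>.\<close>
      then have "Xm (\<lambda>k. - ?f k) * Xm ?f \<in> M" using in_M[OF that] stabD by blast
      then show False using Xm_inv[of ?f] one_notin by (simp only: mult.commute)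
    qed
  qed (auto simp: Xm_0 stab_one Xm_add stab_mult)
  then obtain v' where
      nonneg: "\<forall>e\<in>{e \<in> range (\<lambda>(k, a). ?e k a). Xm e \<in> stab}. 0 \<le> (\<Sum>k\<in>UNIV. of_int (e k) * v' k)"
    and v': "\<forall>i. w $ i = (\<Sum>k\<in>UNIV. of_int (V $ i $ k) * v' k)" by blast
  define v :: "real^'r" where "v = (\<chi> k. v' k)"
  have w_eq: "w = (\<chi> i k. real_of_int (V $ i $ k)) *v v"
    by (simp add: vec_eq_iff matrix_vector_mult_def v_def v')
  have eval_e: "(\<Sum>l\<in>UNIV. of_int (?e k a l) * v' l) = v $ k - v $ a" for k a
    by (simp add: v_def left_diff_distrib sum_subtractf if_distrib[of real_of_int] if_distrib[of "\<lambda>c. c * _"] cong: if_cong)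
  have ratio: "v $ a \<le> v $ k" if "Xm (?e k a) \<in> stab" for a k
  proof -
    have "0 \<le> (\<Sum>l\<in>UNIV. of_int (?e k a l) * v' l)"
      by (rule nonneg[THEN bspec]) (use that in \<open>auto intro!: image_eqI[of _ _ "(k, a)"]\<close>)
    then show ?thesis unfolding eval_e by (simp only: diff_ge_0_iff_ge)
  qed
  have "balanced U v" unfolding balanced_def
  proof (intro allI impI, rule ccontr)
    fix c j
    assume rel: "(\<Sum>k\<in>UNIV. c k *s U $ k) = 0" and "c j \<noteq> 0"
      and no: "\<not> (\<exists>k. k \<noteq> j \<and> c k \<noteq> 0 \<and> v $ k \<le> v $ j)"
    \<comment> \<open>Since \<open>v $ k\<close> exceeds \<open>v $ j\<close>, the ratio of form
      \<open>j\<close> to form \<open>k\<close> is outside \<open>stab\<close>. Its inverse is then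
      in \<open>stab\<close> by totality, and in \<open>M\<close> by
      \<open>stab_inverse\<close>.\<close>
    have small: "Xm (?e k j) \<in> M" if "k \<noteq> j" "c k \<noteq> 0" for k
    proof -
      have "Xm (?e j k) \<notin> stab" using ratio no that by blast
      moreover have "Xm (?e k j) * Xm (?e j k) = 1" using Xm_inv[of "?e k j"] by simp
      ultimately show ?thesis using stab_total stab_inverse by blast
    qed
    \<comment> \<open>Dividing the relation by its term at \<open>j\<close> shows that
      \<open>h\<close> equals 1 on \<open>D\<close>, although every summand lies in
      \<open>M\<close>.\<close>
    define h where "h = (\<Sum>k\<in>UNIV-{j}. (\<lambda>_. - c k / c j) * Xm (?e k j))"
    have "(\<lambda>_. - c k / c j) * Xm (?e k j) \<in> M" if "k \<in> UNIV - {j}" for k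
    proof (cases "c k = 0")
      case True
      then show ?thesis using zero by (simp add: zero_fun_def[symmetric])
    next
      case False
      then show ?thesis using small that by (intro scale) auto
    qed
    then have "h \<in> M" unfolding h_def by (rule sum)
    have "(1 - h) x = 0" if x: "x \<in> D" for x
    proof -
      have Xk: "X k x = (U *v x) $ k" for k using x by (simp add: X_def)
      have ratio_eq: "Xm (?e k j) x = X k x / X j x" for k
      proof -
        have "Xm (?e k j) x = (\<Prod>l\<in>UNIV. (if l = k then X k x else 1) / (if l = j then X j x else 1))"
          unfolding Xm_def using X by (intro prod.cong) (auto simp: power_int_diff)
        then show ?thesis by (simp add: prod_dividef)
      qed
      have "0 = (\<Sum>k\<in>UNIV. c k * X k x)" by (simp add: Xk relation_apply rel)
      also have "\<dots> = c j * X j x + (\<Sum>k\<in>UNIV-{j}. c k * X k x)" by (rule sum.remove) auto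
      finally have eq: "(\<Sum>k\<in>UNIV-{j}. c k * X k x) = - (c j * X j x)" by (simp add: eq_neg_iff_add_eq_0 add.commute)
      have "h x = (\<Sum>k\<in>UNIV-{j}. - (c k * X k x) / (c j * X j x))"
        by (simp add: h_def sum_apply_fun ratio_eq)
      also have "\<dots> = - (\<Sum>k\<in>UNIV-{j}. c k * X k x) / (c j * X j x)"
        by (simp add: sum_divide_distrib sum_negf)
      also have "\<dots> = 1" unfolding eq using \<open>c j \<noteq> 0\<close> X[of j x] by simp
      finally show ?thesis by (simp add: fun_diff_def)
    qed
    \<comment> \<open>Vanishing on \<open>D\<close> is enough for membership in
      \<open>posring\<close>, hence in \<open>M\<close>; adding \<open>h\<close> gives the
      contradiction \<open>1 \<in> M\<close>.\<close>
    then have "1 - h \<in> M" using PM posring.zero by blast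
    from add[OF this \<open>h \<in> M\<close>] show False using one_notin by simp
  qed
  then show ?thesis using w_eq by (rule that)
qed

theorem theorem3p1:
  fixes U :: "complex^'m::finite^'r::finite" and V :: "int^'r^'s::finite"
  shows "tropicalization (Y_UV U V) =
           (\<lambda>w. (\<chi> i k. real_of_int (V $ i $ k)) *v w) ` tropicalization (range (\<lambda>x. U *v x))"
proof (intro subset_antisym subsetI)
  fix w assume "w \<in> tropicalization (Y_UV U V)"
  then obtain v where "balanced U v" "w = (\<chi> i k. real_of_int (V $ i $ k)) *v v"
    by (rule tropicalization_Y_UV_lift)
  then show "w \<in> (\<lambda>w. (\<chi> i k. real_of_int (V $ i $ k)) *v w) ` tropicalization (range (\<lambda>x. U *v x))"
    using balanced_imp_tropicalization by blast
next
  fix w assume "w \<in> (\<lambda>w. (\<chi> i k. real_of_int (V $ i $ k)) *v w) ` tropicalization (range (\<lambda>x. U *v x))"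
  then show "w \<in> tropicalization (Y_UV U V)"
    using tropicalization_imp_balanced balanced_imp_tropicalization_Y_UV by blast
qed

end
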